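(* Let $n\ge 2$ and let $P=P_1\otimes P_2\otimes\cdots\otimes P_n$ be an $n$-qubit Pauli string, with each $P_k\in\{I,X,Y,Z\}$. Assume $P_n\neq I$ and $P_j\neq I$ for at least one $j<n$. Let $\theta\in\mathbb{R}$ be such that the rotation $$e^{-i\theta P}=\alpha I+\beta P,\qquad \alpha=\cos\theta,\ \beta=-i\sin\theta,$$ is not a Clifford unitary. Let $|\phi_n\rangle\in\mathbb{C}^2$ be a single-qubit state. Then the following are equivalent: (i) There exists an $n$-qubit Clifford unitary $\mathcal{U}$ such that, for every $(n-1)$-qubit state $|\Psi\rangle$, the state $\mathcal{U}\,e^{-i\theta P}\big(|\Psi\rangle\otimes|\phi_n\rangle\big)$ is a product state $|\tilde\Psi\rangle\otimes|\tilde\phi_n\rangle$ with respect to the bipartition (first $n-1$ qubits) $|$ (qubit $n$). (ii) $|\phi_n\rangle$ is a single-qubit stabilizer state.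
   Context: The $n$-qubit Clifford group is the group of unitaries (up to global phase) that map the set of $n$-qubit Pauli strings to itself under conjugation. A stabilizer state is a state of the form $C|0\rangle^{\otimes m}$ with $C$ a Clifford unitary. For a single qubit, the stabilizer states are exactly the six eigenstates of $X$, $Y$ and $Z$, up to global phase. Here $X,Y,Z$ are the Pauli matrices and $I$ is the $2\times 2$ identity matrix. *)

theory Defs
  imports Complex_Main "Jordan_Normal_Form.Matrix"
begin

text \<open>Conventions. An m-qubit state is a unit vector in C^(2^m) (a JNF vec of dimension 2^m);
an m-qubit operator is a complex (2^m)x(2^m) matrix. Tensor products are Kronecker products,
qubit 1 being the most significant (leftmost) tensor factor.\<close>

definition kron :: "complex mat \<Rightarrow> complex mat \<Rightarrow> complex mat" where
  "kron A B = mat (dim_row A * dim_row B) (dim_col A * dim_col B)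
     (\<lambda>(i,j). A $$ (i div dim_row B, j div dim_col B) * B $$ (i mod dim_row B, j mod dim_col B))"

definition vkron :: "complex vec \<Rightarrow> complex vec \<Rightarrow> complex vec" where
  "vkron u w = vec (dim_vec u * dim_vec w) (\<lambda>i. u $ (i div dim_vec w) * w $ (i mod dim_vec w))"

definition adj :: "complex mat \<Rightarrow> complex mat" where
  "adj U = mat (dim_col U) (dim_row U) (\<lambda>(i,j). cnj (U $$ (j,i)))"

definition unitary_op :: "nat \<Rightarrow> complex mat \<Rightarrow> bool" where
  "unitary_op m U \<longleftrightarrow> U \<in> carrier_mat (2^m) (2^m) \<and> adj U * U = 1\<^sub>m (2^m)"

definition is_state :: "nat \<Rightarrow> complex vec \<Rightarrow> bool" where
  "is_state m v \<longleftrightarrow> dim_vec v = 2^m \<and> (\<Sum>i<2^m. (cmod (v $ i))\<^sup>2) = 1"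

datatype pauli = PI | PX | PY | PZ

definition pauli_mat :: "pauli \<Rightarrow> complex mat" where
  "pauli_mat p = (case p of
      PI \<Rightarrow> mat_of_rows_list 2 [[1, 0], [0, 1]]
    | PX \<Rightarrow> mat_of_rows_list 2 [[0, 1], [1, 0]]
    | PY \<Rightarrow> mat_of_rows_list 2 [[0, -\<i>], [\<i>, 0]]
    | PZ \<Rightarrow> mat_of_rows_list 2 [[1, 0], [0, -1]])"

fun pstring_mat :: "pauli list \<Rightarrow> complex mat" where
  "pstring_mat [] = 1\<^sub>m 1"
| "pstring_mat (p # ps) = kron (pauli_mat p) (pstring_mat ps)"

definition is_clifford :: "nat \<Rightarrow> complex mat \<Rightarrow> bool" where
  "is_clifford m U \<longleftrightarrow> unitary_op m U \<and>
     (\<forall>ps. length ps = m \<longrightarrow>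
        (\<exists>qs c. length qs = m \<and> U * pstring_mat ps * adj U = c \<cdot>\<^sub>m pstring_mat qs))"

definition zero_state :: "nat \<Rightarrow> complex vec" where
  "zero_state m = unit_vec (2^m) 0"

definition is_stabilizer_state :: "nat \<Rightarrow> complex vec \<Rightarrow> bool" where
  "is_stabilizer_state m v \<longleftrightarrow>
     (\<exists>C c. is_clifford m C \<and> cmod c = 1 \<and> v = c \<cdot>\<^sub>v (C *\<^sub>v zero_state m))"

text \<open>e^{-i\<theta>P} = cos \<theta> I - i sin \<theta> P for a Pauli string P (P^2 = I).\<close>
definition pauli_rot :: "real \<Rightarrow> pauli list \<Rightarrow> complex mat" where
  "pauli_rot \<theta> ps = complex_of_real (cos \<theta>) \<cdot>\<^sub>m 1\<^sub>m (2 ^ length ps)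
       + (- \<i> * complex_of_real (sin \<theta>)) \<cdot>\<^sub>m pstring_mat ps"

definition product_last :: "nat \<Rightarrow> complex vec \<Rightarrow> bool" where
  "product_last k v \<longleftrightarrow> (\<exists>a b. dim_vec a = 2^k \<and> dim_vec b = 2 \<and> v = vkron a b)"

end

theory Submission
  imports Defs "Jordan_Normal_Form.Determinant"
begin

text \<open>
Write \<open>E\<close> for the rotation, \<open>P = P' \<otimes> p\<close> with \<open>p\<close> on the last qubit, and \<open>\<rho>\<close> for the projector onto \<open>\<phi>\<close>.

If \<open>\<phi>\<close> is an eigenvector of a Pauli matrix \<open>Q \<noteq> p\<close> with eigenvalue \<open>s\<close>, then \<open>p \<phi>\<close> belongs to the
eigenvalue \<open>-s\<close>, and the Clifford unitary that applies \<open>P'\<close> controlled on the \<open>-s\<close> eigenspace of \<open>Q\<close>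
removes the entanglement; if \<open>Q = p\<close> there is none.

Conversely, a subspace consisting of product vectors has a fixed factor on one of the two sides. Hence
conjugation by \<open>U E\<close> sends \<open>1 \<otimes> \<rho>\<close> to \<open>1 \<otimes> b\<close> or, for two qubits only, to \<open>a \<otimes> 1\<close>. So every Pauli
string \<open>A\<close> with \<open>tr (A E (1 \<otimes> \<rho>) E\<^sup>*) \<noteq> 0\<close> is mapped by \<open>U\<close> to a Pauli string supported on one and the
same qubit. If two Bloch components \<open>r\<^sub>i\<close>, \<open>r\<^sub>j\<close> of \<open>\<rho>\<close> are nonzero, with \<open>j \<noteq> p\<close>, this holds for
\<open>1 \<otimes> \<sigma>\<^sub>i\<close>, \<open>1 \<otimes> \<sigma>\<^sub>j\<close> and \<open>P' \<otimes> \<sigma>\<^sub>j p\<close> (up to phase), because \<open>sin 2\<theta>\<close> and \<open>cos 2\<theta>\<close> are nonzero.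
Three distinct Pauli matrices on one qubit multiply to a scalar, but the product of these three strings is
traceless since \<open>P' \<noteq> 1\<close>. So \<open>\<rho>\<close> has a single nonzero Bloch component.
\<close>

subsection \<open>Kronecker products, adjoints and traces\<close>

lemma mult_index:
  fixes A B :: "complex mat"
  assumes "A \<in> carrier_mat a b" "B \<in> carrier_mat b c" "i < a" "j < c"
  shows "(A * B) $$ (i,j) = (\<Sum>k<b. A $$ (i,k) * B $$ (k,j))"
  using assms by (simp add: scalar_prod_def lessThan_atLeast0)

lemma mult_vec_index:
  fixes A :: "complex mat"
  assumes "A \<in> carrier_mat a b" "v \<in> carrier_vec b" "i < a"
  shows "(A *\<^sub>v v) $ i = (\<Sum>k<b. A $$ (i,k) * v $ k)"
  using assms by (simp add: scalar_prod_def lessThan_atLeast0)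

lemma smult_smult_mat: "k \<cdot>\<^sub>m (l \<cdot>\<^sub>m A) = (k * l) \<cdot>\<^sub>m (A :: complex mat)"
  by (rule eq_matI) (simp_all add: mult.assoc)

lemma smult_one_mat: "1 \<cdot>\<^sub>m A = (A :: complex mat)"
  by (rule eq_matI) simp_all

lemma zero_smult_add:
  "dim_row A = dim_row B \<Longrightarrow> dim_col A = dim_col B \<Longrightarrow> A + 0 \<cdot>\<^sub>m B = (A :: complex mat)"
  by (rule eq_matI) simp_all

lemma smult_mult_left: "dim_col A = dim_row B \<Longrightarrow> (k \<cdot>\<^sub>m A) * B = k \<cdot>\<^sub>m (A * B :: complex mat)"
  by (rule mult_smult_assoc_mat[of _ "dim_row A" "dim_col A" _ "dim_col B"]) auto

lemma smult_mult_right: "dim_col A = dim_row B \<Longrightarrow> A * (k \<cdot>\<^sub>m B) = k \<cdot>\<^sub>m (A * B :: complex mat)"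
  by (rule mult_smult_distrib[of _ "dim_row A" "dim_col A" _ "dim_col B"]) auto

lemma linear_mult:
  fixes A B P :: "complex mat"
  assumes "A \<in> carrier_mat n n" "B \<in> carrier_mat n n" "P \<in> carrier_mat n n"
  shows "(x \<cdot>\<^sub>m A + y \<cdot>\<^sub>m B) * P = x \<cdot>\<^sub>m (A * P) + y \<cdot>\<^sub>m (B * P)"
    and "P * (x \<cdot>\<^sub>m A + y \<cdot>\<^sub>m B) = x \<cdot>\<^sub>m (P * A) + y \<cdot>\<^sub>m (P * B)"
  using assms
  by (simp_all add: add_mult_distrib_mat[of _ n n] mult_add_distrib_mat[of _ n n _ n] smult_mult_left smult_mult_right)

lemma smult_mult_vec: "dim_col A = dim_vec v \<Longrightarrow> (k \<cdot>\<^sub>m A) *\<^sub>v v = k \<cdot>\<^sub>v (A *\<^sub>v v :: complex vec)"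
  by (rule eq_vecI) (simp_all add: scalar_prod_def sum_distrib_left mult.assoc)

lemma add_mult_vec:
  "dim_col A = dim_vec v \<Longrightarrow> dim_col B = dim_vec v \<Longrightarrow> dim_row A = dim_row B \<Longrightarrow>
    (A + B) *\<^sub>v v = A *\<^sub>v v + (B *\<^sub>v v :: complex vec)"
  by (rule add_mult_distrib_mat_vec[of _ "dim_row A" "dim_vec v"]) auto

lemma mult_vec_smult: "dim_col A = dim_vec v \<Longrightarrow> A *\<^sub>v (k \<cdot>\<^sub>v v) = k \<cdot>\<^sub>v (A *\<^sub>v v :: complex vec)"
  by (rule mult_mat_vec[of _ "dim_row A" "dim_vec v"]) auto

lemma mult_vec_add:
  "dim_col A = dim_vec v \<Longrightarrow> dim_vec w = dim_vec v \<Longrightarrow>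
    A *\<^sub>v (v + w) = A *\<^sub>v v + (A *\<^sub>v w :: complex vec)"
  by (rule mult_add_distrib_mat_vec[of _ "dim_row A" "dim_vec v"]) (auto intro: carrier_vecI)

section \<open>Index arithmetic and the algebra of Kronecker products\<close>

lemma div_mod_less:
  fixes i a b :: nat
  assumes "i < a * b"
  shows "i div b < a" "i mod b < b"
  using assms by (auto simp: less_mult_imp_div_less) (metis mod_less_divisor mult_is_0 neq0_conv not_less0)

lemma mult_add_less:
  fixes i j a b :: nat
  assumes "i < a" "j < b"
  shows "i * b + j < a * b"
proof -
  have "i * b + j < (i + 1) * b" using assms by simp
  also have "\<dots> \<le> a * b" using assms by (intro mult_right_mono) auto
  finally show ?thesis .
qed

text \<open>An index of a tensor product is a two-digit number, so a sum over it is a double sum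
  over its digits.\<close>

lemma sum_div_mod:
  fixes f :: "nat \<Rightarrow> nat \<Rightarrow> 'a::comm_monoid_add"
  shows "(\<Sum>i<a*b. f (i div b) (i mod b)) = (\<Sum>i<a. \<Sum>j<b. f i j)"
  unfolding sum.cartesian_product
  by (rule sum.reindex_bij_witness[where i = "\<lambda>(i,j). i * b + j" and j = "\<lambda>i. (i div b, i mod b)"])
     (auto simp: div_mod_less mult_add_less)

lemma dim_kron [simp]:
  "dim_row (kron A B) = dim_row A * dim_row B"
  "dim_col (kron A B) = dim_col A * dim_col B"
  by (simp_all add: kron_def)

lemma kron_carrier [intro]:
  "A \<in> carrier_mat a b \<Longrightarrow> B \<in> carrier_mat c d \<Longrightarrow> kron A B \<in> carrier_mat (a * c) (b * d)"
  by auto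

lemma kron_index:
  assumes "A \<in> carrier_mat a b" "B \<in> carrier_mat c d" "i < a * c" "j < b * d"
  shows "kron A B $$ (i,j) = A $$ (i div c, j div d) * B $$ (i mod c, j mod d)"
  using assms by (simp add: kron_def)

text \<open>The mixed-product rule: the summand separates in the two digits of the inner index, so
  the double sum is a product of two sums.\<close>

lemma kron_mult:
  assumes A: "A \<in> carrier_mat a b" and B: "B \<in> carrier_mat c d"
    and C: "C \<in> carrier_mat b e" and D: "D \<in> carrier_mat d f"
  shows "kron A B * kron C D = kron (A * C) (B * D)"
proof (rule eq_matI)
  fix i j assume "i < dim_row (kron (A * C) (B * D))" "j < dim_col (kron (A * C) (B * D))"
  then have i: "i < a * c" and j: "j < e * f" using assms by auto
  have "(kron A B * kron C D) $$ (i,j)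
      = (\<Sum>k<b*d. kron A B $$ (i,k) * kron C D $$ (k,j))"
    by (rule mult_index[OF kron_carrier[OF A B] kron_carrier[OF C D] i j])
  also have "\<dots> = (\<Sum>k<b*d. (\<lambda>k l. A $$ (i div c, k) * B $$ (i mod c, l)
      * (C $$ (k, j div f) * D $$ (l, j mod f))) (k div d) (k mod d))"
    using i j by (intro sum.cong refl) (simp add: kron_index[OF A B] kron_index[OF C D])
  also have "\<dots> = (\<Sum>k<b. \<Sum>l<d. A $$ (i div c, k) * B $$ (i mod c, l)
      * (C $$ (k, j div f) * D $$ (l, j mod f)))"
    by (rule sum_div_mod)
  also have "\<dots> = (\<Sum>k<b. A $$ (i div c, k) * C $$ (k, j div f))
      * (\<Sum>l<d. B $$ (i mod c, l) * D $$ (l, j mod f))"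
    by (simp add: sum_product algebra_simps)
  also have "\<dots> = kron (A * C) (B * D) $$ (i,j)"
    using i j div_mod_less[OF i] div_mod_less[OF j]
    by (simp add: kron_index[OF mult_carrier_mat[OF A C] mult_carrier_mat[OF B D]]
        mult_index[OF A C] mult_index[OF B D])
  finally show "(kron A B * kron C D) $$ (i,j) = kron (A * C) (B * D) $$ (i,j)" .
qed (use assms in auto)

lemma dim_vkron [simp]: "dim_vec (vkron u v) = dim_vec u * dim_vec v"
  by (simp add: vkron_def)

lemma kron_mult_vec:
  assumes A: "A \<in> carrier_mat a b" and B: "B \<in> carrier_mat c d"
    and u: "u \<in> carrier_vec b" and v: "v \<in> carrier_vec d"
  shows "kron A B *\<^sub>v vkron u v = vkron (A *\<^sub>v u) (B *\<^sub>v v)"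
proof (rule eq_vecI)
  have uv: "vkron u v \<in> carrier_vec (b * d)" using u v by (intro carrier_vecI) simp
  fix i assume "i < dim_vec (vkron (A *\<^sub>v u) (B *\<^sub>v v))"
  then have i: "i < a * c" using assms by (auto simp: vkron_def)
  have "(kron A B *\<^sub>v vkron u v) $ i = (\<Sum>k<b*d. kron A B $$ (i,k) * vkron u v $ k)"
    by (rule mult_vec_index[OF kron_carrier[OF A B] uv i])
  also have "\<dots> = (\<Sum>k<b*d. (\<lambda>k l. A $$ (i div c, k) * B $$ (i mod c, l)
      * (u $ k * v $ l)) (k div d) (k mod d))"
    using i u v by (intro sum.cong refl) (simp add: kron_index[OF A B] vkron_def)
  also have "\<dots> = (\<Sum>k<b. \<Sum>l<d. A $$ (i div c, k) * B $$ (i mod c, l) * (u $ k * v $ l))"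
    by (rule sum_div_mod)
  also have "\<dots> = (\<Sum>k<b. A $$ (i div c, k) * u $ k) * (\<Sum>l<d. B $$ (i mod c, l) * v $ l)"
    by (simp add: sum_product algebra_simps)
  also have "\<dots> = vkron (A *\<^sub>v u) (B *\<^sub>v v) $ i"
    using i div_mod_less[OF i] A B
    by (simp add: vkron_def mult_vec_index[OF A u] mult_vec_index[OF B v] del: index_mult_mat_vec)
  finally show "(kron A B *\<^sub>v vkron u v) $ i = vkron (A *\<^sub>v u) (B *\<^sub>v v) $ i" .
qed (use assms in \<open>auto simp: vkron_def\<close>)

text \<open>Both bracketings read the same three digits of an index in mixed radix.\<close>

lemma kron_assoc: "kron (kron A B) C = kron A (kron B C)"
proof (rule eq_matI)
  fix i j
  assume "i < dim_row (kron A (kron B C))" "j < dim_col (kron A (kron B C))"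
  then have i: "i < dim_row A * dim_row B * dim_row C" and j: "j < dim_col A * dim_col B * dim_col C"
    by (simp_all add: mult.assoc)
  note * = div_mod_less[OF i] div_mod_less[OF j]
  have i': "i mod (dim_row B * dim_row C) < dim_row B * dim_row C"
    and j': "j mod (dim_col B * dim_col C) < dim_col B * dim_col C"
    using div_mod_less(2)[of i "dim_row A" "dim_row B * dim_row C"]
      div_mod_less(2)[of j "dim_col A" "dim_col B * dim_col C"] i j
    by (simp_all add: mult.assoc)
  have m: "k mod (b * c) mod c = k mod c" "k mod (b * c) div c = k div c mod b" 
      "k div (b * c) = k div c div b" for k b c :: nat
    by (simp_all add: mod_mod_cancel mult.commute[of b] mod_mult2_eq div_mult2_eq) (cases "c = 0"; simp)
  have "kron (kron A B) C $$ (i,j) = A $$ (i div dim_row C div dim_row B, j div dim_col C div dim_col B)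
     * B $$ (i div dim_row C mod dim_row B, j div dim_col C mod dim_col B)
     * C $$ (i mod dim_row C, j mod dim_col C)"
    using i j * unfolding kron_def by simp
  moreover have "kron A (kron B C) $$ (i,j) = A $$ (i div dim_row C div dim_row B, j div dim_col C div dim_col B)
     * (B $$ (i div dim_row C mod dim_row B, j div dim_col C mod dim_col B)
     * C $$ (i mod dim_row C, j mod dim_col C))"
    using i j i' j' unfolding kron_def by (simp add: m mult.assoc)
  ultimately show "kron (kron A B) C $$ (i,j) = kron A (kron B C) $$ (i,j)"
    by simp
qed (simp_all add: mult.assoc)

lemma kron_add_right:
  "dim_row A = dim_row B \<Longrightarrow> dim_col A = dim_col B \<Longrightarrow> kron C (A + B) = kron C A + kron C B"
  by (rule eq_matI) (auto simp: kron_def div_mod_less distrib_left distrib_right)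

lemma kron_smult_left: "kron (c \<cdot>\<^sub>m A) B = c \<cdot>\<^sub>m kron A B"
  by (rule eq_matI) (auto simp: kron_def div_mod_less distrib_left distrib_right)

lemma kron_smult_right: "kron A (c \<cdot>\<^sub>m B) = c \<cdot>\<^sub>m kron A B"
  by (rule eq_matI) (auto simp: kron_def div_mod_less distrib_left distrib_right)

lemma kron_one: "kron (1\<^sub>m a) (1\<^sub>m b) = 1\<^sub>m (a * b)"
proof (rule eq_matI)
  fix i j assume "i < dim_row (1\<^sub>m (a * b) :: complex mat)" "j < dim_col (1\<^sub>m (a * b) :: complex mat)"
  then show "kron (1\<^sub>m a) (1\<^sub>m b) $$ (i,j) = 1\<^sub>m (a * b) $$ (i,j)"
    using div_mod_less[of i a b] div_mod_less[of j a b]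
    by (auto simp: kron_def) (metis div_mult_mod_eq)
qed auto

lemma kron_one_left: "kron (1\<^sub>m (Suc 0)) A = A"
  by (rule eq_matI) (auto simp: kron_def)

lemma kron_one_right: "kron A (1\<^sub>m (Suc 0)) = A"
  by (rule eq_matI) (auto simp: kron_def)

lemma kron_zero_right: "kron A (0\<^sub>m b c) = 0\<^sub>m (dim_row A * b) (dim_col A * c)"
  by (rule eq_matI) (auto simp: kron_def div_mod_less)

lemma vkron_add_left:
  "dim_vec u = dim_vec v \<Longrightarrow> vkron (u + v) w = vkron u w + vkron v w"
  by (rule eq_vecI) (auto simp: vkron_def div_mod_less distrib_left distrib_right)

lemma vkron_add_right:
  "dim_vec u = dim_vec v \<Longrightarrow> vkron w (u + v) = vkron w u + vkron w v"
  by (rule eq_vecI) (auto simp: vkron_def div_mod_less distrib_left distrib_right)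

lemma vkron_smult_left: "vkron (c \<cdot>\<^sub>v u) w = c \<cdot>\<^sub>v vkron u w"
  by (rule eq_vecI) (auto simp: vkron_def div_mod_less distrib_left distrib_right)

lemma vkron_smult_right: "vkron w (c \<cdot>\<^sub>v u) = c \<cdot>\<^sub>v vkron w u"
  by (rule eq_vecI) (auto simp: vkron_def div_mod_less distrib_left distrib_right)

section \<open>Adjoints\<close>

lemma dim_adj [simp]: "dim_row (adj A) = dim_col A" "dim_col (adj A) = dim_row A"
  by (simp_all add: adj_def)

lemma adj_carrier [intro]: "A \<in> carrier_mat a b \<Longrightarrow> adj A \<in> carrier_mat b a"
  by auto

lemma adj_index: "i < dim_col A \<Longrightarrow> j < dim_row A \<Longrightarrow> adj A $$ (i,j) = cnj (A $$ (j,i))"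
  by (simp add: adj_def)

lemma adj_mult:
  assumes A: "A \<in> carrier_mat a b" and B: "B \<in> carrier_mat b c"
  shows "adj (A * B) = adj B * adj A"
proof (rule eq_matI)
  fix i j assume "i < dim_row (adj B * adj A)" "j < dim_col (adj B * adj A)"
  then have ij: "i < c" "j < a" using A B by auto
  then show "adj (A * B) $$ (i,j) = (adj B * adj A) $$ (i,j)"
    using A B by (simp add: adj_index mult_index[OF A B] 
        mult_index[OF adj_carrier[OF B] adj_carrier[OF A]] mult.commute del: index_mult_mat(1))
qed (use A B in auto)

lemma adj_add:
  "dim_row A = dim_row B \<Longrightarrow> dim_col A = dim_col B \<Longrightarrow> adj (A + B) = adj A + adj B"
  by (rule eq_matI) (auto simp: adj_index)

lemma adj_smult: "adj (c \<cdot>\<^sub>m A) = cnj c \<cdot>\<^sub>m adj A"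
  by (rule eq_matI) (auto simp: adj_index)

lemma adj_one [simp]: "adj (1\<^sub>m n) = 1\<^sub>m n"
  by (rule eq_matI) (auto simp: adj_index)

lemma adj_kron: "adj (kron A B) = kron (adj A) (adj B)"
  by (rule eq_matI) (auto simp: adj_def kron_def div_mod_less)

section \<open>The trace: cyclicity, linearity, and multiplicativity on tensor products\<close>

definition tr :: "complex mat \<Rightarrow> complex" where
  "tr A = (\<Sum>i<dim_row A. A $$ (i,i))"

lemma tr_mult_commute:
  assumes A: "A \<in> carrier_mat a b" and B: "B \<in> carrier_mat b a"
  shows "tr (A * B) = tr (B * A)"
proof -
  have "tr (A * B) = (\<Sum>i<a. \<Sum>k<b. A $$ (i,k) * B $$ (k,i))"
    using A by (simp add: tr_def mult_index[OF A B] del: index_mult_mat(1))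
  also have "\<dots> = (\<Sum>k<b. \<Sum>i<a. B $$ (k,i) * A $$ (i,k))"
    by (subst sum.swap) (simp add: mult.commute)
  also have "\<dots> = tr (B * A)"
    using B by (simp add: tr_def mult_index[OF B A] del: index_mult_mat(1))
  finally show ?thesis .
qed

lemma tr_add: "A \<in> carrier_mat n n \<Longrightarrow> B \<in> carrier_mat n n \<Longrightarrow> tr (A + B) = tr A + tr B"
  by (simp add: tr_def sum.distrib)

lemma tr_smult: "A \<in> carrier_mat n n \<Longrightarrow> tr (c \<cdot>\<^sub>m A) = c * tr A"
  by (simp add: tr_def sum_distrib_left)

lemma tr_one: "tr (1\<^sub>m n) = of_nat n"
  by (simp add: tr_def)

lemma tr_kron:
  assumes A: "A \<in> carrier_mat a a" and B: "B \<in> carrier_mat b b"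
  shows "tr (kron A B) = tr A * tr B"
proof -
  have "tr (kron A B) = (\<Sum>i<a*b. (\<lambda>k l. A $$ (k,k) * B $$ (l,l)) (i div b) (i mod b))"
    using A B by (simp add: tr_def kron_index[OF A B])
  also have "\<dots> = tr A * tr B"
    using A B by (subst sum_div_mod) (simp add: tr_def sum_product)
  finally show ?thesis .
qed

subsection \<open>Pauli strings\<close>

text \<open>Explicit entries let products, adjoints and traces evaluate by rewriting, so that facts
  about single Pauli matrices become finite case checks.\<close>

definition mat2 :: "complex \<Rightarrow> complex \<Rightarrow> complex \<Rightarrow> complex \<Rightarrow> complex mat" where
  "mat2 a b c d = mat 2 2 (\<lambda>(i,j). if i = 0 then (if j = 0 then a else b) else (if j = 0 then c else d))"

lemma mat2_carrier [simp]: "mat2 a b c d \<in> carrier_mat 2 2"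
  and dim_mat2 [simp]: "dim_row (mat2 a b c d) = 2" "dim_col (mat2 a b c d) = 2"
  by (simp_all add: mat2_def)

lemma mat2_index [simp]:
  "mat2 a b c d $$ (0,0) = a" "mat2 a b c d $$ (0,Suc 0) = b"
  "mat2 a b c d $$ (Suc 0,0) = c" "mat2 a b c d $$ (Suc 0,Suc 0) = d"
  by (simp_all add: mat2_def)

lemma mat2_eqI:
  assumes "A \<in> carrier_mat 2 2" "A $$ (0,0) = a" "A $$ (0,Suc 0) = b"
    "A $$ (Suc 0,0) = c" "A $$ (Suc 0,Suc 0) = d"
  shows "A = mat2 a b c d"
  using assms by (intro eq_matI) (auto simp: less_2_cases_iff)

lemma mat2_eq_iff: "mat2 a b c d = mat2 a' b' c' d' \<longleftrightarrow> a = a' \<and> b = b' \<and> c = c' \<and> d = d'"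
  by (metis mat2_index)

lemma mat2_mult:
  "mat2 a b c d * mat2 a' b' c' d' = mat2 (a*a'+b*c') (a*b'+b*d') (c*a'+d*c') (c*b'+d*d')"
  by (rule mat2_eqI[OF mult_carrier_mat[OF mat2_carrier mat2_carrier]])
     (simp_all add: mult_index[OF mat2_carrier mat2_carrier] lessThan_nat_numeral del: index_mult_mat(1))

lemma mat2_add: "mat2 a b c d + mat2 a' b' c' d' = mat2 (a+a') (b+b') (c+c') (d+d')"
  by (rule mat2_eqI) simp_all

lemma mat2_smult: "k \<cdot>\<^sub>m mat2 a b c d = mat2 (k*a) (k*b) (k*c) (k*d)"
  by (rule mat2_eqI) simp_all

lemma mat2_adj: "adj (mat2 a b c d) = mat2 (cnj a) (cnj c) (cnj b) (cnj d)"
  by (rule mat2_eqI) (simp_all add: adj_index adj_carrier)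

lemma mat2_tr: "tr (mat2 a b c d) = a + d"
  by (simp add: tr_def eval_nat_numeral)

lemma mat2_one: "1\<^sub>m 2 = mat2 1 0 0 1"
  by (rule mat2_eqI) simp_all

lemma mat2_mult_vec: "dim_vec v = 2 \<Longrightarrow>
    mat2 a b c d *\<^sub>v v = vec 2 (\<lambda>i. if i = 0 then a * v $ 0 + b * v $ 1 else c * v $ 0 + d * v $ 1)"
  by (rule eq_vecI)
     (auto simp: mult_vec_index[OF mat2_carrier carrier_vecI] eval_nat_numeral less_Suc_eq
       simp del: index_mult_mat_vec)

lemmas mat2_simps = mat2_mult mat2_add mat2_smult mat2_adj mat2_tr mat2_one mat2_eq_iff

lemma pauli_mat2:
  "pauli_mat PI = mat2 1 0 0 1" "pauli_mat PX = mat2 0 1 1 0"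
  "pauli_mat PY = mat2 0 (-\<i>) \<i> 0" "pauli_mat PZ = mat2 1 0 0 (-1)"
  by (auto intro!: mat2_eqI simp: pauli_mat_def mat_of_rows_list_def)

lemma pauli_carrier [simp]: "pauli_mat p \<in> carrier_mat 2 2"
  and dim_pauli [simp]: "dim_row (pauli_mat p) = 2" "dim_col (pauli_mat p) = 2"
  by (cases p; simp add: pauli_mat2)+

lemma pauli_PI: "pauli_mat PI = 1\<^sub>m 2"
  by (simp add: pauli_mat2 mat2_one)

lemma pauli_sq: "pauli_mat p * pauli_mat p = 1\<^sub>m 2"
  by (cases p) (simp_all add: pauli_mat2 mat2_simps)

lemma pauli_adj: "adj (pauli_mat p) = pauli_mat p"
  by (cases p) (simp_all add: pauli_mat2 mat2_simps)

lemma tr_pauli: "tr (pauli_mat p) = (if p = PI then 2 else 0)"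
  by (cases p) (simp_all add: pauli_mat2 mat2_simps)

lemma tr_pauli_mult: "tr (pauli_mat p * pauli_mat q) = (if p = q then 2 else 0)"
  by (cases p; cases q) (simp_all add: pauli_mat2 mat2_simps)

lemma tr_pauli_mult3:
  assumes "p \<noteq> PI" "q \<noteq> PI" "r \<noteq> PI" "p \<noteq> q" "q \<noteq> r" "p \<noteq> r"
  shows "tr (pauli_mat p * pauli_mat q * pauli_mat r) \<noteq> 0"
  using assms by (cases p; cases q; cases r) (simp_all add: pauli_mat2 mat2_simps)

text \<open>The product of the Klein four-group, to which the Pauli matrices reduce when phases are
  dropped.\<close>

fun pauli_prod :: "pauli \<Rightarrow> pauli \<Rightarrow> pauli" where
  "pauli_prod PI q = q"
| "pauli_prod p PI = p"
| "pauli_prod PX PX = PI" | "pauli_prod PX PY = PZ" | "pauli_prod PX PZ = PY"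
| "pauli_prod PY PX = PZ" | "pauli_prod PY PY = PI" | "pauli_prod PY PZ = PX"
| "pauli_prod PZ PX = PY" | "pauli_prod PZ PY = PX" | "pauli_prod PZ PZ = PI"

lemma pauli_mult: "\<exists>c. c \<noteq> 0 \<and> pauli_mat p * pauli_mat q = c \<cdot>\<^sub>m pauli_mat (pauli_prod p q)"
  \<comment> \<open>For two distinct nontrivial matrices the phase is \<i> in the cyclic order X, Y,
    Z and -\<i> in the reverse order.\<close>
  by (rule exI[of _ "if p = PI \<or> q = PI \<or> p = q then 1 else
      if (p,q) \<in> {(PX,PY),(PY,PZ),(PZ,PX)} then \<i> else -\<i>"])
     (cases p; cases q; simp add: pauli_mat2 mat2_simps)

text \<open>The commutation sign; complex-valued so that it can serve directly as a scalar factor of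
  matrices.\<close>

definition pauli_sign :: "pauli \<Rightarrow> pauli \<Rightarrow> complex" where
  "pauli_sign p q = (if p = PI \<or> q = PI \<or> p = q then 1 else -1)"

lemma pauli_commute: "pauli_mat p * pauli_mat q = pauli_sign p q \<cdot>\<^sub>m (pauli_mat q * pauli_mat p)"
  by (cases p; cases q) (simp_all add: pauli_mat2 mat2_simps pauli_sign_def)

section \<open>Products, commutation and traces of Pauli strings\<close>

lemma pstring_carrier [simp]: "pstring_mat ps \<in> carrier_mat (2 ^ length ps) (2 ^ length ps)"
  by (induction ps) auto

lemma dim_pstring [simp]:
  "dim_row (pstring_mat ps) = 2 ^ length ps" "dim_col (pstring_mat ps) = 2 ^ length ps"
  using pstring_carrier by blast+

lemma pstring_append: "pstring_mat (ps @ qs) = kron (pstring_mat ps) (pstring_mat qs)"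
  by (induction ps) (simp_all add: kron_one_left kron_assoc)

text \<open>The recursion of \<open>pstring_mat\<close> peels off the first qubit, whereas the
  bipartition singles out the last one.\<close>

lemma pstring_snoc: "pstring_mat (ps @ [q]) = kron (pstring_mat ps) (pauli_mat q)"
  by (simp add: pstring_append kron_one_right)

lemma pstring_replicate_PI: "pstring_mat (replicate m PI) = 1\<^sub>m (2 ^ m)"
  by (induction m) (simp_all add: pauli_PI kron_one)

lemma pstring_sq: "pstring_mat ps * pstring_mat ps = 1\<^sub>m (2 ^ length ps)"
  by (induction ps) (simp_all add: kron_mult[OF pauli_carrier pstring_carrier pauli_carrier pstring_carrier]
      pauli_sq kron_one)

lemma pstring_adj: "adj (pstring_mat ps) = pstring_mat ps"
  by (induction ps) (simp_all add: adj_kron pauli_adj)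

lemma tr_pstring: "tr (pstring_mat ps) = (if set ps \<subseteq> {PI} then 2 ^ length ps else 0)"
  by (induction ps) (simp_all add: tr_kron[OF pauli_carrier pstring_carrier] tr_pauli tr_one)

lemma Cons_mult:
  "length ps = length qs \<Longrightarrow> pstring_mat (p # ps) * pstring_mat (q # qs)
    = kron (pauli_mat p * pauli_mat q) (pstring_mat ps * pstring_mat qs)"
  by (simp, rule kron_mult) (use pstring_carrier[of qs] in auto)

lemma pstring_mult_carrier [simp]:
  "length ps = length qs \<Longrightarrow> pstring_mat ps * pstring_mat qs \<in> carrier_mat (2 ^ length ps) (2 ^ length ps)"
  by (metis mult_carrier_mat pstring_carrier)

text \<open>Hilbert-Schmidt orthogonality: the trace factors over the qubits, and a position where
  the strings differ contributes the factor 0.\<close>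

lemma tr_pstring_mult:
  "length ps = length qs \<Longrightarrow>
    tr (pstring_mat ps * pstring_mat qs) = (if ps = qs then 2 ^ length ps else 0)"
proof (induction ps qs rule: list_induct2)
  case (Cons p ps q qs)
  then show ?case
    by (simp add: Cons_mult tr_kron[OF mult_carrier_mat[OF pauli_carrier pauli_carrier] pstring_mult_carrier] tr_pauli_mult
       del: pstring_mat.simps(2))
qed (simp add: tr_one)

lemma pstring_mult:
  "length ps = length qs \<Longrightarrow>
    \<exists>c rs. c \<noteq> 0 \<and> length rs = length ps \<and> pstring_mat ps * pstring_mat qs = c \<cdot>\<^sub>m pstring_mat rs"
proof (induction ps qs rule: list_induct2)
  case Nil
  then show ?case by (intro exI[of _ 1] exI[of _ "[]"]) auto
next
  case (Cons p ps q qs)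
  then obtain c rs where *: "c \<noteq> 0" "length rs = length ps" "pstring_mat ps * pstring_mat qs = c \<cdot>\<^sub>m pstring_mat rs"
    by blast
  obtain d where d: "d \<noteq> 0" "pauli_mat p * pauli_mat q = d \<cdot>\<^sub>m pauli_mat (pauli_prod p q)"
    using pauli_mult by blast
  show ?case
    using Cons.hyps * d by (intro exI[of _ "c * d"] exI[of _ "pauli_prod p q # rs"])
      (simp add: Cons_mult kron_smult_left kron_smult_right smult_smult_mat del: pstring_mat.simps(2), simp)
qed

text \<open>The sign is the product of the commutation signs of the single positions.\<close>

lemma pstring_commute:
  "length ps = length qs \<Longrightarrow> \<exists>s. (s = 1 \<or> s = -1) \<and>
    pstring_mat ps * pstring_mat qs = s \<cdot>\<^sub>m (pstring_mat qs * pstring_mat ps)"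
proof (induction ps qs rule: list_induct2)
  case Nil
  then show ?case by (intro exI[of _ 1]) auto
next
  case (Cons p ps q qs)
  then obtain s where s: "s = 1 \<or> s = -1" 
    "pstring_mat ps * pstring_mat qs = s \<cdot>\<^sub>m (pstring_mat qs * pstring_mat ps)" by blast
  show ?case
    using Cons.hyps s by (intro exI[of _ "pauli_sign p q * s"])
      (auto simp: Cons_mult pauli_commute[of p q] kron_smult_left kron_smult_right smult_smult_mat pauli_sign_def
        simp del: pstring_mat.simps(2))
qed

subsection \<open>Pauli rotations and Clifford conjugation\<close>

text \<open>The inner \<open>V * U\<close> cancels. In all uses \<open>V\<close> is the adjoint of a
  unitary \<open>U\<close>.\<close>

lemma conj_mult:
  fixes U V X Y :: "complex mat"
  assumes [simp]: "U \<in> carrier_mat n n" "V \<in> carrier_mat n n" "X \<in> carrier_mat n n" "Y \<in> carrier_mat n n"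
    and VU: "V * U = 1\<^sub>m n"
  shows "(U * X * V) * (U * Y * V) = U * (X * Y) * V"
proof -
  have c: "Y * V \<in> carrier_mat n n" by (rule mult_carrier_mat[of _ n n]) simp_all
  have "V * (U * (Y * V)) = (V * U) * (Y * V)"
    by (rule assoc_mult_mat[symmetric, of _ n n _ n _ n]) (use c in simp_all)
  then have "V * (U * (Y * V)) = Y * V"
    unfolding VU using c left_mult_one_mat by metis
  then show ?thesis
    using c by (simp add: assoc_mult_mat[of _ n n _ n _ n] mult_carrier_mat[of _ n n _ n])
qed

lemma tr_conj:
  assumes U: "U \<in> carrier_mat n n" and V: "V \<in> carrier_mat n n" and X: "X \<in> carrier_mat n n"
    and VU: "V * U = 1\<^sub>m n"
  shows "tr (U * X * V) = tr X"
proof -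
  have "tr (U * X * V) = tr (V * (U * X))"
    using U V X by (intro tr_mult_commute[of _ n n]) auto
  also have "V * (U * X) = X"
    using assoc_mult_mat[OF V U X] VU X by simp
  finally show ?thesis .
qed

text \<open>Moving \<open>P\<close> past \<open>A\<close> costs the factor \<open>s\<close>, and
  \<open>A * P * P = A\<close>; so all four products lie in the span of \<open>A\<close> and
  \<open>A * P\<close>.\<close>

lemma sandwich_involution:
  fixes A P :: "complex mat"
  assumes A: "A \<in> carrier_mat n n" and P: "P \<in> carrier_mat n n"
    and PP: "P * P = 1\<^sub>m n" and PA: "P * A = s \<cdot>\<^sub>m (A * P)"
  shows "(x \<cdot>\<^sub>m 1\<^sub>m n + y \<cdot>\<^sub>m P) * A * (u \<cdot>\<^sub>m 1\<^sub>m n + v \<cdot>\<^sub>m P)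
    = (x * u + s * y * v) \<cdot>\<^sub>m A + (s * y * u + x * v) \<cdot>\<^sub>m (A * P)"
proof -
  have AP: "A * P \<in> carrier_mat n n" using A P by simp
  have APP: "A * P * P = A" using A P PP by simp
  have "(x \<cdot>\<^sub>m 1\<^sub>m n + y \<cdot>\<^sub>m P) * A = x \<cdot>\<^sub>m A + (y * s) \<cdot>\<^sub>m (A * P)"
    using A P AP by (simp add: linear_mult[of _ n] PA smult_smult_mat)
  moreover have "(x \<cdot>\<^sub>m A + (y * s) \<cdot>\<^sub>m (A * P)) * (u \<cdot>\<^sub>m 1\<^sub>m n + v \<cdot>\<^sub>m P)
      = u \<cdot>\<^sub>m (x \<cdot>\<^sub>m A + (y * s) \<cdot>\<^sub>m (A * P)) + v \<cdot>\<^sub>m (x \<cdot>\<^sub>m (A * P) + (y * s) \<cdot>\<^sub>m A)"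
    using A P AP by (simp add: linear_mult[of _ n] APP del: assoc_mult_mat)
  moreover have "\<dots> = (x * u + s * y * v) \<cdot>\<^sub>m A + (s * y * u + x * v) \<cdot>\<^sub>m (A * P)"
    using A P AP by (intro eq_matI) (simp_all add: algebra_simps del: index_mult_mat(1))
  ultimately show ?thesis by simp
qed

lemma pauli_rot_carrier [simp]: "pauli_rot \<theta> ps \<in> carrier_mat (2 ^ length ps) (2 ^ length ps)"
  by (simp add: pauli_rot_def)

lemma dim_pauli_rot [simp]:
  "dim_row (pauli_rot \<theta> ps) = 2 ^ length ps" "dim_col (pauli_rot \<theta> ps) = 2 ^ length ps"
  using pauli_rot_carrier by blast+

lemma pauli_rot_adj: "adj (pauli_rot \<theta> ps) = pauli_rot (- \<theta>) ps"
  by (simp add: pauli_rot_def adj_add adj_smult pstring_adj)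

text \<open>In \<open>sandwich_involution\<close> with the coefficients of the two rotations,
  \<open>s = 1\<close> makes the cross terms cancel, and \<open>s = -1\<close> produces the
  double-angle formulas. The adjoint stands on the left because rotations will be moved from a state
  onto an observable.\<close>

lemma pauli_rot_conj:
  assumes "length ps = n" and A: "A \<in> carrier_mat (2^n) (2^n)"
    and "pstring_mat ps * A = s \<cdot>\<^sub>m (A * pstring_mat ps)" and "s = 1 \<or> s = -1"
  shows "adj (pauli_rot \<theta> ps) * A * pauli_rot \<theta> ps = (if s = 1 then A
    else of_real (cos (2 * \<theta>)) \<cdot>\<^sub>m A + (- \<i> * of_real (sin (2 * \<theta>))) \<cdot>\<^sub>m (A * pstring_mat ps))"
proof -
  let ?P = "pstring_mat ps"
  have P: "?P \<in> carrier_mat (2^n) (2^n)" "?P * ?P = 1\<^sub>m (2^n)"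
    using pstring_carrier[of ps] pstring_sq[of ps] assms(1) by simp_all
  have c: "complex_of_real (cos \<theta>) * cos \<theta> = 1 - complex_of_real (sin \<theta>) * sin \<theta>"
    using sin_cos_squared_add2[of \<theta>] 
    by (metis add_diff_cancel_left' of_real_1 of_real_add of_real_mult sin_cos_squared_add3 add.commute)
  have "adj (pauli_rot \<theta> ps) * A * pauli_rot \<theta> ps
      = (cos \<theta> * cos \<theta> + s * (\<i> * sin \<theta>) * (-\<i> * sin \<theta>)) \<cdot>\<^sub>m A
        + (s * (\<i> * sin \<theta>) * cos \<theta> + cos \<theta> * (-\<i> * sin \<theta>)) \<cdot>\<^sub>m (A * ?P)"
    using sandwich_involution[OF A P assms(3)] assms(1)
    by (simp add: pauli_rot_adj) (simp add: pauli_rot_def)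
  then show ?thesis using assms(4) P(1) A
    unfolding sin_double cos_double
    by (auto simp: c smult_one_mat zero_smult_add power2_eq_square algebra_simps)
qed

text \<open>The identity commutes with the string, so conjugation returns it unchanged.\<close>

lemma pauli_rot_unitary: "unitary_op (length ps) (pauli_rot \<theta> ps)"
  using pauli_rot_conj[of ps "length ps" "1\<^sub>m (2 ^ length ps)" 1 \<theta>]
  by (simp add: unitary_op_def smult_one_mat pauli_rot_adj)

text \<open>A conjugated Pauli string is unchanged or a combination of two Pauli strings weighted by
  \<open>cos (2 * \<theta>)\<close> and \<open>sin (2 * \<theta>)\<close>; if one weight vanishes, a
  single string is left. The contrapositive turns the non-Clifford assumption into two
  inequalities.\<close>

lemma pauli_rot_clifford:
  assumes "sin (2 * \<theta>) = 0 \<or> cos (2 * \<theta>) = 0"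
  shows "is_clifford (length ps) (pauli_rot \<theta> ps)"
  unfolding is_clifford_def
proof (intro conjI allI impI pauli_rot_unitary)
  fix as :: "pauli list" assume l: "length as = length ps"
  obtain s where s: "s = 1 \<or> s = -1"
    "pstring_mat ps * pstring_mat as = s \<cdot>\<^sub>m (pstring_mat as * pstring_mat ps)"
    using pstring_commute[of ps as] l by auto
  obtain c rs where rs: "length rs = length as" "pstring_mat as * pstring_mat ps = c \<cdot>\<^sub>m pstring_mat rs"
    using pstring_mult[of as ps] l by auto
  let ?E = "pauli_rot \<theta> ps * pstring_mat as * adj (pauli_rot \<theta> ps)"
  \<comment> \<open>\<open>pauli_rot_conj\<close> at angle \<open>-\<theta>\<close> puts the
    rotation itself on the left and its adjoint on the right.\<close>
  have *: "?E = (if s = 1 then pstring_mat as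
    else of_real (cos (2 * \<theta>)) \<cdot>\<^sub>m pstring_mat as + (\<i> * of_real (sin (2 * \<theta>)) * c) \<cdot>\<^sub>m pstring_mat rs)"
    using pauli_rot_conj[of ps "length ps" "pstring_mat as" s "-\<theta>"] s l pstring_carrier[of as]
    by (simp add: pauli_rot_adj rs smult_smult_mat)
  have "\<exists>qs d. length qs = length ps \<and> ?E = d \<cdot>\<^sub>m pstring_mat qs"
  proof (cases "s = 1")
    case True
    then have "?E = 1 \<cdot>\<^sub>m pstring_mat as" using * by auto
    then show ?thesis using l by blast
  next
    case False
    from assms show ?thesis
    proof
      assume "sin (2 * \<theta>) = 0"
      then have "?E = of_real (cos (2 * \<theta>)) \<cdot>\<^sub>m pstring_mat as"
        using * False rs by auto
      then show ?thesis using l by blast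
    next
      assume "cos (2 * \<theta>) = 0"
      then have "?E = (\<i> * of_real (sin (2 * \<theta>)) * c) \<cdot>\<^sub>m pstring_mat rs"
        using * False rs by auto
      then show ?thesis using l rs by metis
    qed
  qed
  then show "\<exists>qs c. length qs = length ps \<and> ?E = c \<cdot>\<^sub>m pstring_mat qs" .
qed

section \<open>Traces of Pauli strings under Clifford conjugation\<close>

lemma clifford_unitary: "is_clifford m U \<Longrightarrow> unitary_op m U"
  by (simp add: is_clifford_def)

text \<open>Conjugation by a unitary is multiplicative and preserves traces, so the phases of the
  images factor out.\<close>

lemma clifford_conj_trace:
  assumes U: "unitary_op m U" and "length A = m" "length B = m" "length C = m"
    and "length A' = m" "length B' = m" "length C' = m"
    and A: "U * pstring_mat A * adj U = a \<cdot>\<^sub>m pstring_mat A'"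
    and B: "U * pstring_mat B * adj U = b \<cdot>\<^sub>m pstring_mat B'"
    and C: "U * pstring_mat C * adj U = c \<cdot>\<^sub>m pstring_mat C'"
  shows "tr (pstring_mat A) = a * tr (pstring_mat A')"
    and "tr (pstring_mat A * pstring_mat B) = a * b * tr (pstring_mat A' * pstring_mat B')"
    and "tr (pstring_mat A * pstring_mat B * pstring_mat C)
      = a * b * c * tr (pstring_mat A' * pstring_mat B' * pstring_mat C')"
proof -
  have [simp]: "U \<in> carrier_mat (2^m) (2^m)" "adj U * U = 1\<^sub>m (2^m)" "adj U \<in> carrier_mat (2^m) (2^m)"
    using U by (auto simp: unitary_op_def)
  have [simp]: "pstring_mat X \<in> carrier_mat (2^m) (2^m)" if "X \<in> {A,B,C,A',B',C'}" for X
    using that assms pstring_carrier[of X] by auto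
  have [simp]: "pstring_mat A * pstring_mat B \<in> carrier_mat (2^m) (2^m)"
    "pstring_mat A' * pstring_mat B' \<in> carrier_mat (2^m) (2^m)"
    "pstring_mat A * pstring_mat B * pstring_mat C \<in> carrier_mat (2^m) (2^m)"
    "pstring_mat A' * pstring_mat B' * pstring_mat C' \<in> carrier_mat (2^m) (2^m)"
    by (intro mult_carrier_mat[of _ "2^m" "2^m"]; simp)+
  show "tr (pstring_mat A) = a * tr (pstring_mat A')"
    by (subst tr_conj[of U "2^m" "adj U" "pstring_mat A", symmetric]) (simp_all add: A tr_smult[of _ "2^m"])
  have AB: "U * (pstring_mat A * pstring_mat B) * adj U = (a * b) \<cdot>\<^sub>m (pstring_mat A' * pstring_mat B')"
    by (subst conj_mult[of U "2^m", symmetric])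
      (simp_all add: A B smult_mult_left smult_mult_right smult_smult_mat assms(2-7) ac_simps)
  show "tr (pstring_mat A * pstring_mat B) = a * b * tr (pstring_mat A' * pstring_mat B')"
    by (subst tr_conj[of U "2^m" "adj U", symmetric]) (simp_all add: AB tr_smult[of _ "2^m"] del: assoc_mult_mat)
  have ABC: "U * (pstring_mat A * pstring_mat B * pstring_mat C) * adj U 
      = (a * b * c) \<cdot>\<^sub>m (pstring_mat A' * pstring_mat B' * pstring_mat C')"
    by (subst conj_mult[of U "2^m" _ "pstring_mat A * pstring_mat B", symmetric])
      (simp_all add: AB C smult_mult_left smult_mult_right smult_smult_mat assms(2-7) ac_simps
       del: assoc_mult_mat)
  show "tr (pstring_mat A * pstring_mat B * pstring_mat C)
      = a * b * c * tr (pstring_mat A' * pstring_mat B' * pstring_mat C')"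
    by (subst tr_conj[of U "2^m" "adj U", symmetric]) (simp_all add: ABC tr_smult[of _ "2^m"] del: assoc_mult_mat)
qed

subsection \<open>Single-qubit stabilizer states\<close>

lemma pstring_single: "pstring_mat [p] = pauli_mat p"
  by (simp add: kron_one_right)

lemma length_Suc_0_conv: "length ps = Suc 0 \<longleftrightarrow> (\<exists>p. ps = [p])"
  by (cases ps) auto

lemma clifford_1_iff:
  "is_clifford (Suc 0) U \<longleftrightarrow> U \<in> carrier_mat 2 2 \<and> adj U * U = 1\<^sub>m 2 \<and>
    (\<forall>p. \<exists>q c. U * pauli_mat p * adj U = c \<cdot>\<^sub>m pauli_mat q)"
proof -
  have *: "(\<forall>ps. length ps = Suc 0 \<longrightarrow> R ps) \<longleftrightarrow> (\<forall>p. R [p])"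
    "(\<exists>qs c. length qs = Suc 0 \<and> S qs c) \<longleftrightarrow> (\<exists>q c. S [q] c)"
    for R :: "pauli list \<Rightarrow> bool" and S :: "pauli list \<Rightarrow> complex \<Rightarrow> bool"
    unfolding length_Suc_0_conv by blast+
  show ?thesis
    unfolding is_clifford_def unitary_op_def * pstring_single by simp
qed

text \<open>Z fixes the zero state, so the conjugate of Z by \<open>C\<close> fixes its image under
  \<open>C\<close>; this conjugate is a Pauli matrix \<open>Q\<close> times a phase
  \<open>d\<close>.\<close>

lemma stabilizer_imp_eigenvector:
  assumes "is_stabilizer_state (Suc 0) \<phi>"
  shows "\<exists>Q s. Q \<noteq> PI \<and> (s = 1 \<or> s = -1) \<and> pauli_mat Q *\<^sub>v \<phi> = s \<cdot>\<^sub>v \<phi>"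
proof -
  obtain C c where C: "is_clifford (Suc 0) C" and \<phi>: "\<phi> = c \<cdot>\<^sub>v (C *\<^sub>v zero_state (Suc 0))"
    using assms by (auto simp: is_stabilizer_state_def)
  have C': "C \<in> carrier_mat 2 2" "adj C \<in> carrier_mat 2 2" "adj C * C = 1\<^sub>m 2"
    using C by (auto simp: clifford_1_iff)
  obtain Q d where Q: "C * pauli_mat PZ * adj C = d \<cdot>\<^sub>m pauli_mat Q"
    using C unfolding clifford_1_iff by metis
  have l: "length [p] = Suc 0" for p :: pauli by simp
  have *: "C * pstring_mat [PZ] * adj C = d \<cdot>\<^sub>m pstring_mat [Q]"
    unfolding pstring_single by (rule Q)
  note tr = clifford_conj_trace[OF clifford_unitary[OF C] l l l l l l * * *, unfolded pstring_single]
  \<comment> \<open>If \<open>Q\<close> were \<open>PI\<close>, then tr Z = 0 would give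
    \<open>d = 0\<close>, contradicting tr (Z Z) = 2.\<close>
  have "Q \<noteq> PI" using tr(1,2) by (auto simp: tr_pauli tr_pauli_mult)
  moreover have "d * d = 1" using tr(2) by (simp add: tr_pauli_mult)
  then have d: "d = 1 \<or> d = -1" by (simp add: square_eq_1_iff)
  moreover have "pauli_mat Q *\<^sub>v \<phi> = d \<cdot>\<^sub>v \<phi>"
  proof -
    let ?e = "zero_state (Suc 0)"
    have e: "?e \<in> carrier_vec 2" "pauli_mat PZ *\<^sub>v ?e = ?e"
      by (auto simp: zero_state_def pauli_mat2 mat2_mult_vec)
    have Ce: "C *\<^sub>v ?e \<in> carrier_vec 2" using C'(1) e(1) by simp
    have "(C * pauli_mat PZ * adj C) *\<^sub>v (C *\<^sub>v ?e) = (C * pauli_mat PZ) *\<^sub>v (adj C *\<^sub>v (C *\<^sub>v ?e))"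
      using C' Ce by (intro assoc_mult_mat_vec[of _ 2 2 _ 2]) auto
    also have "adj C *\<^sub>v (C *\<^sub>v ?e) = ?e"
      using assoc_mult_mat_vec[OF C'(2,1) e(1)] C'(3) e(1) by simp
    also have "(C * pauli_mat PZ) *\<^sub>v ?e = C *\<^sub>v ?e"
      using C' e by (simp add: assoc_mult_mat_vec[of _ 2 2 _ 2])
    finally have "d \<cdot>\<^sub>v (pauli_mat Q *\<^sub>v (C *\<^sub>v ?e)) = C *\<^sub>v ?e"
      using C' by (simp add: Q smult_mult_vec)
    then have "pauli_mat Q *\<^sub>v (C *\<^sub>v ?e) = d \<cdot>\<^sub>v (C *\<^sub>v ?e)"
      using \<open>d * d = 1\<close> by (metis smult_smult_assoc one_smult_vec)
    then show ?thesis
      using C' by (simp add: \<phi> mult_vec_smult smult_smult_assoc mult.commute)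
  qed
  ultimately show ?thesis by blast
qed

section \<open>Clifford unitaries that prepare the six single-qubit stabilizer states\<close>

lemma clifford_1_id: "is_clifford (Suc 0) (1\<^sub>m 2)"
  unfolding clifford_1_iff
  by (intro conjI allI; simp) (rule exI, rule exI[of _ 1], rule smult_one_mat[symmetric])

lemma clifford_1_X: "is_clifford (Suc 0) (pauli_mat PX)"
  unfolding clifford_1_iff
proof (intro conjI allI)
  fix p
  have "pauli_mat PX * pauli_mat p * adj (pauli_mat PX) = pauli_sign PX p \<cdot>\<^sub>m pauli_mat p"
    by (cases p) (simp_all add: pauli_adj pauli_sign_def pauli_mat2 mat2_simps)
  then show "\<exists>q c. pauli_mat PX * pauli_mat p * adj (pauli_mat PX) = c \<cdot>\<^sub>m pauli_mat q" by blast
qed (simp_all add: pauli_adj pauli_sq)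

text \<open>A Hadamard gate followed by diag(1, \<open>s\<close>), which is a power of the phase
  gate. It sends the zero state to (1, \<open>s\<close>) / sqrt 2, an eigenstate of X or Y.\<close>

lemma clifford_1_phase_hadamard:
  assumes "s \<in> {1,-1,\<i>,-\<i>}"
  shows "is_clifford (Suc 0) (of_real (1 / sqrt 2) \<cdot>\<^sub>m mat2 1 1 s (-s))"
proof -
  define h where "h = complex_of_real (1 / sqrt 2)"
  define M where "M = mat2 1 1 s (-s)"
  have h: "h * h = 1/2" "cnj h = h"
    by (simp_all add: h_def flip: of_real_mult)
  have h': "h * (h * 2) = 1" "h * (h * (2 * x)) = x" for x
    using h(1) by (simp_all flip: mult.assoc)
  \<comment> \<open>The Hadamard gate swaps X and Z and negates Y; diag(1, \<open>s\<close>) fixes Z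
    and, for imaginary \<open>s\<close>, exchanges X and Y up to sign. \<open>?k\<close> records the
    resulting signs.\<close>
  let ?q = "\<lambda>p. case p of PI \<Rightarrow> PI | PX \<Rightarrow> PZ
     | PY \<Rightarrow> if s = 1 \<or> s = -1 then PY else PX | PZ \<Rightarrow> if s = 1 \<or> s = -1 then PX else PY"
  let ?k = "\<lambda>p. case p of PI \<Rightarrow> 1 | PX \<Rightarrow> 1 | PY \<Rightarrow> (if s = 1 \<or> s = -1 then -s else s / \<i>)
        | PZ \<Rightarrow> (if s = 1 \<or> s = -1 then s else s / \<i>)"
  \<comment> \<open>Leaving \<open>M\<close> unnormalised keeps the case check free of square roots;
    the factor 2 is later cancelled by \<open>h * h\<close>.\<close>
  have M: "M * pauli_mat p * adj M = (2 * ?k p) \<cdot>\<^sub>m pauli_mat (?q p)" for p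
    unfolding M_def using assms
    by (elim insertE emptyE; cases p; simp add: pauli_mat2 mat2_simps complex_eq_iff)
  have "adj M * M = 2 \<cdot>\<^sub>m 1\<^sub>m 2"
    unfolding M_def using assms by (elim insertE emptyE; simp add: mat2_simps)
  then have "adj (h \<cdot>\<^sub>m M) * (h \<cdot>\<^sub>m M) = 1\<^sub>m 2"
    by (simp add: adj_smult smult_mult_left smult_mult_right smult_smult_mat h h' smult_one_mat)
  moreover have "h \<cdot>\<^sub>m M * pauli_mat p * adj (h \<cdot>\<^sub>m M) = ?k p \<cdot>\<^sub>m pauli_mat (?q p)" for p
  proof -
    have "h \<cdot>\<^sub>m M * pauli_mat p * adj (h \<cdot>\<^sub>m M) = (h * h) \<cdot>\<^sub>m (M * pauli_mat p * adj M)"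
      by (simp add: M_def adj_smult smult_mult_left smult_mult_right smult_smult_mat h(2) del: assoc_mult_mat)
    then show ?thesis unfolding M smult_smult_mat h(1) by simp
  qed
  ultimately show ?thesis
    unfolding clifford_1_iff h_def[symmetric] M_def[symmetric]
    by (intro conjI allI exI) (auto simp: M_def)
qed

lemma is_state_1_iff:
  "is_state (Suc 0) \<phi> \<longleftrightarrow> dim_vec \<phi> = 2 \<and> (cmod (\<phi> $ 0))\<^sup>2 + (cmod (\<phi> $ Suc 0))\<^sup>2 = 1"
  by (simp add: is_state_def eval_nat_numeral)

text \<open>The state is a computational basis vector times a phase, namely its nonzero component;
  the identity or X prepares it.\<close>

lemma stabilizer_if_component_0:
  assumes "is_state (Suc 0) \<phi>" "\<phi> $ 0 = 0 \<or> \<phi> $ Suc 0 = 0"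
  shows "is_stabilizer_state (Suc 0) \<phi>"
  unfolding is_stabilizer_state_def
proof (cases "\<phi> $ Suc 0 = 0")
  case True
  then show "\<exists>C c. is_clifford (Suc 0) C \<and> cmod c = 1 \<and> \<phi> = c \<cdot>\<^sub>v (C *\<^sub>v zero_state (Suc 0))"
    using assms clifford_1_id
    by (intro exI[of _ "1\<^sub>m 2"] exI[of _ "\<phi> $ 0"])
       (auto simp: is_state_1_iff zero_state_def abs_square_eq_1 less_2_cases_iff
         intro!: eq_vecI)
next
  case False
  then show "\<exists>C c. is_clifford (Suc 0) C \<and> cmod c = 1 \<and> \<phi> = c \<cdot>\<^sub>v (C *\<^sub>v zero_state (Suc 0))"
    using assms clifford_1_X
    by (intro exI[of _ "pauli_mat PX"] exI[of _ "\<phi> $ Suc 0"])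
       (auto simp: is_state_1_iff zero_state_def abs_square_eq_1 less_2_cases_iff
          pauli_mat2 mat2_mult_vec intro!: eq_vecI)
qed

text \<open>As \<open>s\<close> has modulus 1, normalisation makes \<open>sqrt 2\<close> times the
  first component a phase; the rest is the vector (1, \<open>s\<close>) / sqrt 2.\<close>

lemma stabilizer_if_component_ratio:
  assumes "is_state (Suc 0) \<phi>" "\<phi> $ Suc 0 = s * \<phi> $ 0" "s \<in> {1,-1,\<i>,-\<i>}"
  shows "is_stabilizer_state (Suc 0) \<phi>"
proof -
  have s: "cmod s = 1" using assms(3) by auto
  have "2 * (cmod (\<phi> $ 0))\<^sup>2 = 1" and d: "dim_vec \<phi> = 2"
    using assms(1) by (simp_all add: is_state_1_iff assms(2) norm_mult s)
  then have "(cmod (of_real (sqrt 2) * \<phi> $ 0))\<^sup>2 = 1"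
    by (simp add: norm_mult power_mult_distrib)
  then have c: "cmod (of_real (sqrt 2) * \<phi> $ 0) = 1"
    by (simp only: abs_square_eq_1 abs_norm_cancel)
  have "\<phi> = (of_real (sqrt 2) * \<phi> $ 0) \<cdot>\<^sub>v ((of_real (1 / sqrt 2) \<cdot>\<^sub>m mat2 1 1 s (-s)) *\<^sub>v zero_state (Suc 0))"
    using d assms(2) by (intro eq_vecI)
      (auto simp: zero_state_def less_2_cases_iff mat2_smult mat2_mult_vec)
  then show ?thesis
    unfolding is_stabilizer_state_def using clifford_1_phase_hadamard[OF assms(3)] c by blast
qed

subsection \<open>Controlled Pauli strings\<close>

text \<open>For \<open>Q \<noteq> PI\<close> and \<open>s\<close> = 1 or -1, the projector onto the
  eigenspace of \<open>Q\<close> for the eigenvalue \<open>s\<close>.\<close>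

definition pauli_proj :: "pauli \<Rightarrow> complex \<Rightarrow> complex mat" where
  "pauli_proj Q s = (1/2) \<cdot>\<^sub>m 1\<^sub>m 2 + (s/2) \<cdot>\<^sub>m pauli_mat Q"

lemma pauli_proj_carrier [simp]: "pauli_proj Q s \<in> carrier_mat 2 2"
  and dim_pauli_proj [simp]: "dim_row (pauli_proj Q s) = 2" "dim_col (pauli_proj Q s) = 2"
  by (simp_all add: pauli_proj_def)

text \<open>The last qubit is the control and the \<open>N\<close>-dimensional factor the target, as
  in a CNOT gate.\<close>

definition controlled_pauli :: "nat \<Rightarrow> complex mat \<Rightarrow> pauli \<Rightarrow> complex \<Rightarrow> complex mat" where
  "controlled_pauli N P Q s = kron (1\<^sub>m N) (pauli_proj Q s) + kron P (pauli_proj Q (-s))"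

lemma pauli_proj_eigenvector:
  assumes "pauli_mat Q *\<^sub>v v = e \<cdot>\<^sub>v v" "dim_vec v = 2"
  shows "pauli_proj Q s *\<^sub>v v = ((1 + s * e) / 2) \<cdot>\<^sub>v v"
proof -
  have "pauli_proj Q s *\<^sub>v v = (1/2) \<cdot>\<^sub>v v + (s/2) \<cdot>\<^sub>v (e \<cdot>\<^sub>v v)"
    using assms one_mult_mat_vec[OF carrier_vecI[of v 2]]
    by (simp add: pauli_proj_def add_mult_vec smult_mult_vec)
  also have "\<dots> = ((1 + s * e) / 2) \<cdot>\<^sub>v v"
    by (rule eq_vecI) (simp_all add: field_simps)
  finally show ?thesis .
qed

text \<open>A matrix commuting with \<open>Q\<close> preserves the two eigenspaces of
  \<open>Q\<close>, and an anticommuting one swaps them, so two of the four blocks vanish. The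
  signed sums follow from \<open>Ep\<close> - \<open>Em\<close> = \<open>s\<close>
  \<open>Q\<close>.\<close>

lemma pauli_proj_sandwich:
  assumes "Q \<noteq> PI" "s = 1 \<or> s = -1"
  defines "Ep \<equiv> pauli_proj Q s" and "Em \<equiv> pauli_proj Q (-s)"
  shows "pauli_sign Q B = 1 \<Longrightarrow> Ep * pauli_mat B * Em = 0\<^sub>m 2 2 \<and> Em * pauli_mat B * Ep = 0\<^sub>m 2 2 \<and>
      Ep * pauli_mat B * Ep + Em * pauli_mat B * Em = pauli_mat B \<and>
      Ep * pauli_mat B * Ep + (-1) \<cdot>\<^sub>m (Em * pauli_mat B * Em) = s \<cdot>\<^sub>m (pauli_mat Q * pauli_mat B)"
    and "pauli_sign Q B \<noteq> 1 \<Longrightarrow> Ep * pauli_mat B * Ep = 0\<^sub>m 2 2 \<and> Em * pauli_mat B * Em = 0\<^sub>m 2 2 \<and>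
      Ep * pauli_mat B * Em + Em * pauli_mat B * Ep = pauli_mat B \<and>
      Ep * pauli_mat B * Em + (-1) \<cdot>\<^sub>m (Em * pauli_mat B * Ep) = s \<cdot>\<^sub>m (pauli_mat Q * pauli_mat B)"
proof -
  have z: "0\<^sub>m 2 2 = mat2 0 0 0 0" by (rule mat2_eqI) simp_all
  note * = Ep_def Em_def pauli_proj_def pauli_mat2 mat2_simps pauli_sign_def z
  show "pauli_sign Q B = 1 \<Longrightarrow> Ep * pauli_mat B * Em = 0\<^sub>m 2 2 \<and> Em * pauli_mat B * Ep = 0\<^sub>m 2 2 \<and>
      Ep * pauli_mat B * Ep + Em * pauli_mat B * Em = pauli_mat B \<and>
      Ep * pauli_mat B * Ep + (-1) \<cdot>\<^sub>m (Em * pauli_mat B * Em) = s \<cdot>\<^sub>m (pauli_mat Q * pauli_mat B)"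
    using assms(1,2) by (elim disjE; cases Q; cases B; simp add: *)
  show "pauli_sign Q B \<noteq> 1 \<Longrightarrow> Ep * pauli_mat B * Ep = 0\<^sub>m 2 2 \<and> Em * pauli_mat B * Em = 0\<^sub>m 2 2 \<and>
      Ep * pauli_mat B * Em + Em * pauli_mat B * Ep = pauli_mat B \<and>
      Ep * pauli_mat B * Em + (-1) \<cdot>\<^sub>m (Em * pauli_mat B * Ep) = s \<cdot>\<^sub>m (pauli_mat Q * pauli_mat B)"
    using assms(1,2) by (elim disjE; cases Q; cases B; simp add: *)
qed

lemma controlled_pauli_carrier:
  "P \<in> carrier_mat N N \<Longrightarrow> controlled_pauli N P Q s \<in> carrier_mat (N * 2) (N * 2)"
  by (auto simp: controlled_pauli_def)

lemma controlled_pauli_adj: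
  "P \<in> carrier_mat N N \<Longrightarrow> adj P = P \<Longrightarrow> s = 1 \<or> s = -1 \<Longrightarrow>
    adj (controlled_pauli N P Q s) = controlled_pauli N P Q s"
  by (auto simp: controlled_pauli_def pauli_proj_def adj_add adj_smult adj_kron pauli_adj)

text \<open>The propagation rule of a controlled gate: a \<open>B\<close> anticommuting with
  \<open>Q\<close> puts a \<open>P\<close> on the target, and an \<open>A\<close> anticommuting with
  \<open>P\<close> puts a \<open>Q\<close> on the control. The proof expands in the eigenspaces of
  \<open>Q\<close>.\<close>

lemma controlled_pauli_conj:
  assumes P: "P \<in> carrier_mat N N" and A: "A \<in> carrier_mat N N" and PP: "P * P = 1\<^sub>m N"
    and PA: "P * A = t \<cdot>\<^sub>m (A * P)" and t: "t = 1 \<or> t = -1"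
    and Q: "Q \<noteq> PI" "s = 1 \<or> s = -1"
  shows "controlled_pauli N P Q s * kron A (pauli_mat B) * controlled_pauli N P Q s
    = kron (if pauli_sign Q B = 1 then A else A * P)
        (if t = 1 then pauli_mat B else s \<cdot>\<^sub>m (pauli_mat Q * pauli_mat B))"
proof -
  let ?Ep = "pauli_proj Q s" and ?Em = "pauli_proj Q (-s)" and ?B = "pauli_mat B"
  have AP [simp]: "A * P \<in> carrier_mat N N" "P * A \<in> carrier_mat N N" using A P by simp_all
  have PAP: "P * A * P = t \<cdot>\<^sub>m A"
    unfolding PA using assoc_mult_mat[OF A P P] A P PP by (simp add: smult_mult_left)
  have E: "?Ep * ?B \<in> carrier_mat 2 2" "?Em * ?B \<in> carrier_mat 2 2"
    by (rule mult_carrier_mat[of _ 2 2 _ 2]; simp)+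
  have [simp]: "X * ?B * Y \<in> carrier_mat 2 2" if "X \<in> {?Ep,?Em}" "Y \<in> {?Ep,?Em}" for X Y
    using that mult_carrier_mat[of _ 2 2 _ 2] by auto
  have k: "kron X Y \<in> carrier_mat (N * 2) (N * 2)" if "X \<in> carrier_mat N N" "Y \<in> carrier_mat 2 2" for X Y
    using that by auto
  have "controlled_pauli N P Q s * kron A ?B = kron A (?Ep * ?B) + kron (P * A) (?Em * ?B)"
    unfolding controlled_pauli_def using P A
    by (subst add_mult_distrib_mat[of _ "N * 2" "N * 2" _ _ "N * 2"])
      (auto simp: k kron_mult[OF _ pauli_proj_carrier _ pauli_carrier, of _ N N _ N])
  moreover have "\<dots> * controlled_pauli N P Q s =
      (kron A (?Ep * ?B * ?Ep) + kron (P * A * P) (?Em * ?B * ?Em))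
      + (kron (A * P) (?Ep * ?B * ?Em) + kron (P * A) (?Em * ?B * ?Ep))"
  proof -
    \<comment> \<open>The terms are grouped into diagonal and off-diagonal blocks with respect to
      the eigenspaces of the control.\<close>
    have expand: "(kron X Y + kron X' Y') * (kron (1\<^sub>m N) Z + kron W Z')
       = (kron X (Y * Z) + kron (X' * W) (Y' * Z')) + (kron (X * W) (Y * Z') + kron X' (Y' * Z))"
      if c: "X \<in> carrier_mat N N" "X' \<in> carrier_mat N N" "W \<in> carrier_mat N N"
         "Y \<in> carrier_mat 2 2" "Y' \<in> carrier_mat 2 2" "Z \<in> carrier_mat 2 2" "Z' \<in> carrier_mat 2 2"
      for X X' W Y Y' Z Z'
    proof -
      have 1: "X * 1\<^sub>m N = X" "X' * 1\<^sub>m N = X'" using c by simp_all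
      have "(kron X Y + kron X' Y') * (kron (1\<^sub>m N) Z + kron W Z')
        = (kron X Y * kron (1\<^sub>m N) Z + kron X' Y' * kron (1\<^sub>m N) Z)
          + (kron X Y * kron W Z' + kron X' Y' * kron W Z')"
        using c by (simp add: k mult_add_distrib_mat[of _ "N*2" "N*2" _ "N*2"]
           add_mult_distrib_mat[of _ "N*2" "N*2" _ _ "N*2"])
      also have "\<dots> = (kron X (Y * Z) + kron X' (Y' * Z))
          + (kron (X * W) (Y * Z') + kron (X' * W) (Y' * Z'))"
        by (simp only: kron_mult[OF c(1) c(4) one_carrier_mat c(6)] kron_mult[OF c(2) c(5) one_carrier_mat c(6)]
           kron_mult[OF c(1) c(4) c(3) c(7)] kron_mult[OF c(2) c(5) c(3) c(7)] 1)
      also have "\<dots> = (kron X (Y * Z) + kron (X' * W) (Y' * Z')) + (kron (X * W) (Y * Z') + kron X' (Y' * Z))"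
        using c by (intro eq_matI) (auto simp: kron_index simp del: index_mult_mat(1))
      finally show ?thesis .
    qed
    show ?thesis unfolding controlled_pauli_def
      by (rule expand[OF A AP(2) P E pauli_proj_carrier pauli_proj_carrier])
  qed
  \<comment> \<open>Pulling out \<open>t\<close> gives the two terms of each group a common first
    factor; the remaining sums are those of \<open>pauli_proj_sandwich\<close>, with plus for
    \<open>t = 1\<close> and minus for \<open>t = -1\<close>.\<close>
  moreover have "\<dots> = (kron A (?Ep * ?B * ?Ep + t \<cdot>\<^sub>m (?Em * ?B * ?Em)))
      + (kron (A * P) (?Ep * ?B * ?Em + t \<cdot>\<^sub>m (?Em * ?B * ?Ep)))"
    unfolding PAP unfolding PA
    by (simp add: kron_add_right kron_smult_left kron_smult_right)
  ultimately have eq: "controlled_pauli N P Q s * kron A ?B * controlled_pauli N P Q s = \<dots>"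
    by simp
  have z: "X + 0\<^sub>m (N * 2) (N * 2) = X" "0\<^sub>m (N * 2) (N * 2) + X = X" "(-1) \<cdot>\<^sub>m 0\<^sub>m 2 2 = (0\<^sub>m 2 2 :: complex mat)"
    "0\<^sub>m 2 2 + 0\<^sub>m 2 2 = (0\<^sub>m 2 2 :: complex mat)" 
    if "X \<in> carrier_mat (N * 2) (N * 2)" for X :: "complex mat"
    using that by auto
  have d: "dim_row A = N" "dim_col A = N" "dim_row (A * P) = N" "dim_col (A * P) = N" 
    using A P by auto
  show ?thesis
    unfolding eq using t pauli_proj_sandwich[OF Q, of B]
    by (auto simp: smult_one_mat z k A d kron_zero_right simp del: index_mult_mat assoc_mult_mat)
qed

text \<open>After splitting off the last letter of a string, both tensor factors given by
  \<open>controlled_pauli_conj\<close> are again Pauli strings up to a scalar.\<close>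

lemma controlled_pauli_clifford:
  assumes Q: "Q \<noteq> PI" "s = 1 \<or> s = -1"
  shows "is_clifford (Suc (length as)) (controlled_pauli (2 ^ length as) (pstring_mat as) Q s)"
proof -
  define m where "m = length as"
  define P where "P = pstring_mat as"
  define U where "U = controlled_pauli (2^m) P Q s"
  have P: "P \<in> carrier_mat (2^m) (2^m)" "P * P = 1\<^sub>m (2^m)" "adj P = P"
    by (simp_all add: P_def m_def pstring_sq pstring_adj)
  have U: "U \<in> carrier_mat (2 ^ Suc m) (2 ^ Suc m)" "adj U = U"
    using controlled_pauli_carrier[OF P(1)] controlled_pauli_adj[OF P(1,3) Q(2)]
    by (simp_all add: U_def mult.commute)
  \<comment> \<open>The gate is self-adjoint, so its unitarity is the conjugation rule for the
    identity string.\<close>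
  have "U * kron (1\<^sub>m (2^m)) (pauli_mat PI) * U = kron (1\<^sub>m (2^m)) (pauli_mat PI)"
    using controlled_pauli_conj[OF P(1) one_carrier_mat P(2) _ _ Q, of 1 PI] P(1)
    by (simp add: U_def smult_one_mat pauli_sign_def)
  then have "adj U * U = 1\<^sub>m (2 ^ Suc m)"
    using U by (simp add: pauli_PI kron_one mult.commute)
  then have un: "unitary_op (Suc m) U"
    using U by (simp add: unitary_op_def)
  have "\<exists>qs c. length qs = Suc m \<and> U * pstring_mat bs * adj U = c \<cdot>\<^sub>m pstring_mat qs"
    if "length bs = Suc m" for bs
  proof -
    have "bs = butlast bs @ [last bs]" "length (butlast bs) = m"
      using that by (cases bs rule: rev_cases; simp)+
    then obtain cs B where bs: "bs = cs @ [B]" and l: "length cs = m"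
      by blast
    have las: "length cs = length as" using l m_def by simp
    obtain t where t: "t = 1 \<or> t = -1" "P * pstring_mat cs = t \<cdot>\<^sub>m (pstring_mat cs * P)"
      using pstring_commute[OF las[symmetric]] unfolding P_def by blast
    obtain c ds where c: "length ds = m" "(if pauli_sign Q B = 1 then pstring_mat cs else pstring_mat cs * P)
        = c \<cdot>\<^sub>m pstring_mat ds"
    proof (cases "pauli_sign Q B = 1")
      case True
      then show ?thesis using that[of cs 1] l by (simp add: smult_one_mat)
    next
      case False
      obtain c ds where "length ds = length cs" "pstring_mat cs * P = c \<cdot>\<^sub>m pstring_mat ds"
        using pstring_mult[OF las] unfolding P_def by blast
      then show ?thesis using False that[of ds c] l by simp
    qed
    obtain d D where d: "(if t = 1 then pauli_mat B else s \<cdot>\<^sub>m (pauli_mat Q * pauli_mat B)) = d \<cdot>\<^sub>m pauli_mat D"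
    proof (cases "t = 1")
      case True
      then show ?thesis using that[of 1 B] by (simp add: smult_one_mat)
    next
      case False
      obtain c where "pauli_mat Q * pauli_mat B = c \<cdot>\<^sub>m pauli_mat (pauli_prod Q B)"
        using pauli_mult by blast
      then show ?thesis using False that[of "s * c" "pauli_prod Q B"] by (simp add: smult_smult_mat)
    qed
    have cs: "pstring_mat cs \<in> carrier_mat (2^m) (2^m)" using l by auto
    have "U * pstring_mat bs * adj U = (c * d) \<cdot>\<^sub>m pstring_mat (ds @ [D])"
      unfolding bs pstring_snoc U(2) unfolding U_def
      by (subst controlled_pauli_conj[OF P(1) cs P(2) t(2,1) Q])
         (simp add: c d kron_smult_left kron_smult_right smult_smult_mat mult.commute)
    then show ?thesis using c(1) by (metis length_append_singleton)
  qed
  then show ?thesis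
    using un unfolding is_clifford_def U_def P_def m_def by blast
qed

lemma clifford_id: "is_clifford m (1\<^sub>m (2^m))"
  unfolding is_clifford_def unitary_op_def
  by (auto intro!: exI[of _ 1] simp: smult_one_mat)

lemma pauli_rot_snoc_vkron:
  assumes "dim_vec \<Psi> = 2 ^ length as" "dim_vec \<phi> = 2"
  shows "pauli_rot \<theta> (as @ [p]) *\<^sub>v vkron \<Psi> \<phi> = of_real (cos \<theta>) \<cdot>\<^sub>v vkron \<Psi> \<phi>
    + (- \<i> * of_real (sin \<theta>)) \<cdot>\<^sub>v vkron (pstring_mat as *\<^sub>v \<Psi>) (pauli_mat p *\<^sub>v \<phi>)"
proof -
  have v: "vkron \<Psi> \<phi> \<in> carrier_vec (2 ^ length (as @ [p]))"
    using assms by (intro carrier_vecI) simp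
  have "pauli_rot \<theta> (as @ [p]) *\<^sub>v vkron \<Psi> \<phi>
    = of_real (cos \<theta>) \<cdot>\<^sub>v (1\<^sub>m (2 ^ length (as @ [p])) *\<^sub>v vkron \<Psi> \<phi>)
      + (- \<i> * of_real (sin \<theta>)) \<cdot>\<^sub>v (pstring_mat (as @ [p]) *\<^sub>v vkron \<Psi> \<phi>)"
    unfolding pauli_rot_def using assms by (simp add: add_mult_vec smult_mult_vec)
  then show ?thesis
    unfolding one_mult_mat_vec[OF v] pstring_snoc
    by (simp add: kron_mult_vec[OF pstring_carrier pauli_carrier] carrier_vecI assms)
qed

lemma stabilizer_imp_product:
  assumes stab: "is_stabilizer_state (Suc 0) \<phi>" and dim: "dim_vec \<phi> = 2"
  shows "\<exists>U. is_clifford (Suc (length as)) U \<and>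
            (\<forall>\<Psi>. dim_vec \<Psi> = 2 ^ length as \<longrightarrow>
               product_last (length as) (U *\<^sub>v (pauli_rot \<theta> (as @ [p]) *\<^sub>v vkron \<Psi> \<phi>)))"
proof -
  define N :: nat where "N = 2 ^ length as"
  define P where "P = pstring_mat as"
  define k where "k = - \<i> * complex_of_real (sin \<theta>)"
  have P: "P \<in> carrier_mat N N" "P * P = 1\<^sub>m N" 
    by (simp_all add: P_def N_def pstring_sq)
  obtain Q s where Q: "Q \<noteq> PI" and s: "s = 1 \<or> s = -1" and Q\<phi>: "pauli_mat Q *\<^sub>v \<phi> = s \<cdot>\<^sub>v \<phi>"
    using stabilizer_imp_eigenvector[OF stab] by blast
  have rot: "pauli_rot \<theta> (as @ [p]) *\<^sub>v vkron \<Psi> \<phi>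
      = of_real (cos \<theta>) \<cdot>\<^sub>v vkron \<Psi> \<phi> + k \<cdot>\<^sub>v vkron (P *\<^sub>v \<Psi>) (pauli_mat p *\<^sub>v \<phi>)"
    if "dim_vec \<Psi> = N" for \<Psi>
    using pauli_rot_snoc_vkron[of \<Psi> as \<phi> \<theta> p] that dim by (simp add: N_def P_def k_def)
  show ?thesis
  proof (cases "\<exists>s. pauli_mat p *\<^sub>v \<phi> = s \<cdot>\<^sub>v \<phi>")
    case True
    then obtain s' where s': "pauli_mat p *\<^sub>v \<phi> = s' \<cdot>\<^sub>v \<phi>" by blast
    have "product_last (length as) (1\<^sub>m (2 ^ Suc (length as)) *\<^sub>v (pauli_rot \<theta> (as @ [p]) *\<^sub>v vkron \<Psi> \<phi>))"
      if d: "dim_vec \<Psi> = 2 ^ length as" for \<Psi>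
    proof -
      have "pauli_rot \<theta> (as @ [p]) *\<^sub>v vkron \<Psi> \<phi> \<in> carrier_vec (2 ^ Suc (length as))"
        by (rule carrier_vecI) simp
      \<comment> \<open>When \<open>\<phi>\<close> is an eigenvector of \<open>p\<close>, the
        rotation acts on the first factor only.\<close>
      moreover have "pauli_rot \<theta> (as @ [p]) *\<^sub>v vkron \<Psi> \<phi>
          = vkron (of_real (cos \<theta>) \<cdot>\<^sub>v \<Psi> + (k * s') \<cdot>\<^sub>v (P *\<^sub>v \<Psi>)) \<phi>"
        using d P(1) by (simp add: rot N_def s' vkron_add_left vkron_smult_left vkron_smult_right smult_smult_assoc)
      ultimately show ?thesis
        unfolding product_last_def using d dim P(1)
        by (intro exI[of _ "of_real (cos \<theta>) \<cdot>\<^sub>v \<Psi> + (k * s') \<cdot>\<^sub>v (P *\<^sub>v \<Psi>)"] exI[of _ \<phi>]) (simp add: N_def)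
    qed
    then show ?thesis using clifford_id by blast
  next
    case False
    \<comment> \<open>Either equality would make \<open>\<phi>\<close> an eigenvector of
      \<open>p\<close>; so \<open>p\<close> and \<open>Q\<close> anticommute.\<close>
    then have pQ: "p \<noteq> PI" "p \<noteq> Q"
      using Q\<phi> dim one_mult_mat_vec[OF carrier_vecI[OF dim]] one_smult_vec[of \<phi>] 
      by (metis pauli_PI, metis)
    define \<chi> where "\<chi> = pauli_mat p *\<^sub>v \<phi>"
    have \<chi>: "dim_vec \<chi> = 2" by (simp add: \<chi>_def)
    have v: "\<phi> \<in> carrier_vec 2" "\<chi> \<in> carrier_vec 2" using dim \<chi> by (auto intro: carrier_vecI)
    have "pauli_mat Q *\<^sub>v \<chi> = (pauli_mat Q * pauli_mat p) *\<^sub>v \<phi>"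
      unfolding \<chi>_def by (rule assoc_mult_mat_vec[symmetric, OF pauli_carrier pauli_carrier v(1)])
    also have "\<dots> = (- 1) \<cdot>\<^sub>v ((pauli_mat p * pauli_mat Q) *\<^sub>v \<phi>)"
      using pQ Q dim by (subst pauli_commute) (simp add: pauli_sign_def smult_mult_vec)
    also have "(pauli_mat p * pauli_mat Q) *\<^sub>v \<phi> = s \<cdot>\<^sub>v \<chi>"
      unfolding \<chi>_def using dim
      by (subst assoc_mult_mat_vec[OF pauli_carrier pauli_carrier v(1)]) (simp add: Q\<phi> mult_vec_smult)
    finally have Q\<chi>: "pauli_mat Q *\<^sub>v \<chi> = (- s) \<cdot>\<^sub>v \<chi>" by (simp add: smult_smult_assoc)
    have z: "0 \<cdot>\<^sub>v u = 0\<^sub>v (dim_vec u)" for u :: "complex vec" by (rule eq_vecI) simp_all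
    have E: "pauli_proj Q s *\<^sub>v \<phi> = \<phi>" "pauli_proj Q (-s) *\<^sub>v \<phi> = 0\<^sub>v 2"
      "pauli_proj Q s *\<^sub>v \<chi> = 0\<^sub>v 2" "pauli_proj Q (-s) *\<^sub>v \<chi> = \<chi>"
      using s pauli_proj_eigenvector[OF Q\<phi> dim, of s] pauli_proj_eigenvector[OF Q\<phi> dim, of "-s"]
        pauli_proj_eigenvector[OF Q\<chi> \<chi>, of s] pauli_proj_eigenvector[OF Q\<chi> \<chi>, of "-s"]
      by (auto simp: z dim \<chi>)
    define U where "U = controlled_pauli N P Q s"
    have U: "U \<in> carrier_mat (N * 2) (N * 2)" unfolding U_def by (rule controlled_pauli_carrier[OF P(1)])
    have kz: "vkron u (0\<^sub>v 2) = 0\<^sub>v (dim_vec u * 2)" for u by (rule eq_vecI) (simp_all add: vkron_def)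
    \<comment> \<open>The control is off on \<open>\<phi>\<close>, which has eigenvalue
      \<open>s\<close>, and on for \<open>\<chi>\<close>, which has eigenvalue
      \<open>-s\<close>.\<close>
    have U\<phi>: "U *\<^sub>v vkron u \<phi> = vkron u \<phi>" and U\<chi>: "U *\<^sub>v vkron u \<chi> = vkron (P *\<^sub>v u) \<chi>"
      if u: "u \<in> carrier_vec N" for u
    proof -
      have d: "dim_vec u = N" "dim_row P = N" "dim_col P = N" using u P(1) by auto
      have k: "kron A (pauli_proj Q e) *\<^sub>v vkron u w = vkron (A *\<^sub>v u) (pauli_proj Q e *\<^sub>v w)"
        if "w \<in> carrier_vec 2" "A \<in> carrier_mat N N" for w A e
        by (rule kron_mult_vec[OF that(2) pauli_proj_carrier u that(1)])
      show "U *\<^sub>v vkron u \<phi> = vkron u \<phi>"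
        unfolding U_def controlled_pauli_def using u d dim
        by (subst add_mult_vec) (auto simp: k[OF v(1)] P(1) E kz intro!: right_zero_vec carrier_vecI)
      show "U *\<^sub>v vkron u \<chi> = vkron (P *\<^sub>v u) \<chi>"
        unfolding U_def controlled_pauli_def using u d \<chi>
        by (subst add_mult_vec) (auto simp: k[OF v(2)] P(1) E kz intro!: left_zero_vec carrier_vecI)
    qed
    have "product_last (length as) (U *\<^sub>v (pauli_rot \<theta> (as @ [p]) *\<^sub>v vkron \<Psi> \<phi>))"
      if d: "dim_vec \<Psi> = 2 ^ length as" for \<Psi>
    proof -
      have \<Psi>: "\<Psi> \<in> carrier_vec N" "P *\<^sub>v \<Psi> \<in> carrier_vec N"
        using d P(1) by (auto simp: N_def intro: carrier_vecI)
      have PP: "P *\<^sub>v (P *\<^sub>v \<Psi>) = \<Psi>"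
        using assoc_mult_mat_vec[OF P(1) P(1) \<Psi>(1)] P(2) \<Psi>(1) by simp
      have "U *\<^sub>v (pauli_rot \<theta> (as @ [p]) *\<^sub>v vkron \<Psi> \<phi>)
          = of_real (cos \<theta>) \<cdot>\<^sub>v (U *\<^sub>v vkron \<Psi> \<phi>) + k \<cdot>\<^sub>v (U *\<^sub>v vkron (P *\<^sub>v \<Psi>) \<chi>)"
        using carrier_vecD[OF \<Psi>(1)] carrier_matD[OF U] carrier_matD[OF P(1)] dim \<chi> by (simp add: rot \<chi>_def[symmetric] mult_vec_add mult_vec_smult)
      \<comment> \<open>The controlled \<open>P\<close> cancels the \<open>P\<close> that the
        rotation attached to \<open>\<chi>\<close>, so both terms share the first factor
        \<open>\<Psi>\<close>.\<close>
      also have "\<dots> = vkron \<Psi> (of_real (cos \<theta>) \<cdot>\<^sub>v \<phi> + k \<cdot>\<^sub>v \<chi>)"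
        using U\<phi>[OF \<Psi>(1)] U\<chi>[OF \<Psi>(2)] by (simp add: PP vkron_add_right vkron_smult_right dim \<chi>)
      finally show ?thesis
        unfolding product_last_def using d dim \<chi>
        by (intro exI[of _ \<Psi>] exI[of _ "of_real (cos \<theta>) \<cdot>\<^sub>v \<phi> + k \<cdot>\<^sub>v \<chi>"]) simp
    qed
    moreover have "is_clifford (Suc (length as)) U"
      unfolding U_def P_def N_def by (rule controlled_pauli_clifford[OF Q s])
    ultimately show ?thesis by blast
  qed
qed

subsection \<open>Isometries with product image\<close>

text \<open>\<open>r\<close> is the Euclidean norm of \<open>f\<close>, positive because of the
  entry at \<open>i0\<close>.\<close>

lemma unit_column:
  fixes f :: "nat \<Rightarrow> complex"
  assumes "i0 < n" "f i0 \<noteq> 0"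
  obtains r where "r \<noteq> 0" "adj (mat n 1 (\<lambda>(i,_). f i / r)) * mat n 1 (\<lambda>(i,_). f i / r) = 1\<^sub>m 1"
proof -
  define q where "q = (\<Sum>i<n. (cmod (f i))\<^sup>2)"
  have "(cmod (f i0))\<^sup>2 \<le> q"
    unfolding q_def using assms(1) by (intro member_le_sum) auto
  moreover have "0 < (cmod (f i0))\<^sup>2" using assms(2) by simp
  ultimately have q: "q > 0" by linarith
  define r where "r = complex_of_real (sqrt q)"
  have r: "r \<noteq> 0" "cnj r * r = of_real q"
    using q by (simp_all add: r_def flip: of_real_mult)
  let ?F = "mat n 1 (\<lambda>(i,_). f i / r)"
  have F: "?F \<in> carrier_mat n 1" by simp
  have "(adj ?F * ?F) $$ (0,0) = (\<Sum>i<n. cnj (f i / r) * (f i / r))"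
    by (subst mult_index[OF adj_carrier[OF F] F]) (auto simp: adj_index)
  also have "\<dots> = (\<Sum>i<n. of_real ((cmod (f i))\<^sup>2)) / of_real q"
    by (simp only: sum_divide_distrib complex_norm_square r(2)[symmetric]) (simp add: mult.commute)
  also have "\<dots> = 1"
    using q unfolding of_real_sum[symmetric] q_def[symmetric] by simp
  finally have "adj ?F * ?F = 1\<^sub>m 1"
    by (intro eq_matI) simp_all
  then show ?thesis using that r(1) by blast
qed

text \<open>All 2 by 2 minors of the pair vanish, so the ratio at \<open>i0\<close> is the ratio
  everywhere.\<close>

lemma proportional:
  fixes u v :: "nat \<Rightarrow> complex"
  assumes "\<And>i j. i < n \<Longrightarrow> j < n \<Longrightarrow> u i * v j = u j * v i" "i0 < n" "v i0 \<noteq> 0"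
  shows "\<exists>c. \<forall>i<n. u i = c * v i"
  using assms by (intro exI[of _ "u i0 / v i0"]) (simp add: field_simps)

lemma isometry_dim_le:
  assumes B: "B \<in> carrier_mat k n" and BB: "adj B * B = 1\<^sub>m n"
  shows "n \<le> k"
proof (rule ccontr)
  assume "\<not> n \<le> k"
  then have kn: "k < n" by simp
  txt \<open>Padding \<open>B\<close> with zero rows yields a square isometry, which would be unitary.\<close>
  define C where "C = mat n n (\<lambda>(i,j). if i < k then B $$ (i,j) else 0)"
  have C: "C \<in> carrier_mat n n" by (simp add: C_def)
  have "adj C * C = adj B * B"
  proof (rule eq_matI)
    fix i j assume "i < dim_row (adj B * B)" "j < dim_col (adj B * B)"
    then have ij: "i < n" "j < n" using B by auto
    have "(adj C * C) $$ (i,j) = (\<Sum>l<n. adj C $$ (i,l) * C $$ (l,j))"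
      by (rule mult_index[OF adj_carrier[OF C] C ij])
    also have "\<dots> = (\<Sum>l<k. adj B $$ (i,l) * B $$ (l,j))"
      using ij kn B by (intro sum.mono_neutral_cong_right) (auto simp: C_def adj_index)
    also have "\<dots> = (adj B * B) $$ (i,j)"
      by (rule mult_index[OF adj_carrier[OF B] B ij, symmetric])
    finally show "(adj C * C) $$ (i,j) = (adj B * B) $$ (i,j)" .
  qed (use B C in auto)
  then have CC: "C * adj C = 1\<^sub>m n"
    using mat_mult_left_right_inverse[OF adj_carrier[OF C] C] BB by simp
  have "(C * adj C) $$ (k,k) = (\<Sum>l<n. C $$ (k,l) * adj C $$ (l,k))"
    by (rule mult_index[OF C adj_carrier[OF C] kn kn])
  also have "\<dots> = 0" using kn by (intro sum.neutral) (simp add: C_def)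
  finally show False using kn by (simp add: CC)
qed

text \<open>Each column of \<open>M\<close> is a product of some \<open>a k\<close> and
  \<open>b k\<close>. If all \<open>b k\<close> are parallel, then \<open>M\<close> is a unitary
  tensor a unit column. Otherwise all \<open>a k\<close> are parallel, and \<open>M\<close> is a
  unit column tensor an isometry into dimension 2, which forces \<open>N = 2\<close>.\<close>

lemma product_isometry_projector:
  assumes M: "M \<in> carrier_mat (N * 2) N" and MM: "adj M * M = 1\<^sub>m N" and N: "N \<ge> 2"
    and prod: "\<And>v. v \<in> carrier_vec N \<Longrightarrow> \<exists>a b. dim_vec a = N \<and> dim_vec b = 2 \<and> M *\<^sub>v v = vkron a b"
  shows "(\<exists>b \<in> carrier_mat 2 2. M * adj M = kron (1\<^sub>m N) b)
    \<or> (N = 2 \<and> (\<exists>a \<in> carrier_mat 2 2. M * adj M = kron a (1\<^sub>m 2)))"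
proof -
  have col: "(M *\<^sub>v unit_vec N k) $ i = M $$ (i,k)" if "k < N" "i < N * 2" for i k
  proof -
    have "(M *\<^sub>v unit_vec N k) $ i = (\<Sum>l<N. M $$ (i,l) * unit_vec N k $ l)"
      by (rule mult_vec_index[OF M _ that(2)]) simp
    also have "\<dots> = (\<Sum>l<N. if l = k then M $$ (i,k) else 0)"
      using that by (intro sum.cong) auto
    finally show ?thesis using that by simp
  qed
  have lt: "i * 2 + j < N * 2" "(i * 2 + j) div 2 = i" "(i * 2 + j) mod 2 = j" if "i < N" "j < 2" for i j
    using that by auto
  \<comment> \<open>The bound on \<open>k\<close> sits inside the existential so that the factors
    can be chosen as functions of \<open>k\<close>.\<close>
  have "\<forall>k. \<exists>a b. k < N \<longrightarrow> (\<forall>i<N. \<forall>j<2. M $$ (i * 2 + j, k) = a i * b j)"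
  proof
    fix k
    show "\<exists>a b. k < N \<longrightarrow> (\<forall>i<N. \<forall>j<2. M $$ (i * 2 + j, k) = a i * b j)"
    proof (cases "k < N")
      case True
      obtain a b where ab: "dim_vec a = N" "dim_vec b = 2" "M *\<^sub>v unit_vec N k = vkron a b"
        using prod[of "unit_vec N k"] by auto
      have "M $$ (i * 2 + j, k) = a $ i * b $ j" if "i < N" "j < 2" for i j
        using col[OF True lt(1)[OF that]] lt[OF that] ab by (simp add: vkron_def)
      then show ?thesis by (intro exI[of _ "($) a"] exI[of _ "($) b"]) simp
    qed simp
  qed
  then obtain a b where ab: "\<And>i j k. k < N \<Longrightarrow> i < N \<Longrightarrow> j < 2 \<Longrightarrow> M $$ (i * 2 + j, k) = a k i * b k j"
    by metis
  have ab': "M $$ (i,k) = a k (i div 2) * b k (i mod 2)" if "k < N" "i < N * 2" for i k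
    using ab[OF that(1), of "i div 2" "i mod 2"] that div_mod_less[OF that(2)] by simp
  \<comment> \<open>An isometry has no zero column, so neither factor of a column vanishes.\<close>
  have nz: "(\<exists>i<N. a k i \<noteq> 0) \<and> (\<exists>j<2. b k j \<noteq> 0)" if k: "k < N" for k
  proof (rule ccontr)
    assume neg: "\<not> ?thesis"
    have "M $$ (i,k) = 0" if "i < N * 2" for i
      using ab'[OF k that] neg div_mod_less[OF that] by auto
    moreover have "(adj M * M) $$ (k,k) = (\<Sum>l<N * 2. adj M $$ (k,l) * M $$ (l,k))"
      by (rule mult_index[OF adj_carrier[OF M] M k k])
    ultimately show False using k by (simp add: MM)
  qed
  txt \<open>Since the sum of columns \<open>k\<close> and \<open>l\<close> is again a product vector, their first factors or their second
    factors are proportional.\<close>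
  have pol: "(b k 0 * b l 1 - b k 1 * b l 0) * (a k i * a l i' - a k i' * a l i) = 0"
    if kl: "k < N" "l < N" and i: "i < N" "i' < N" for k l i i'
  proof -
    obtain u w where uw: "dim_vec u = N" "dim_vec w = 2" "M *\<^sub>v (unit_vec N k + unit_vec N l) = vkron u w"
      using prod[of "unit_vec N k + unit_vec N l"] by auto
    have "M *\<^sub>v (unit_vec N k + unit_vec N l) = M *\<^sub>v unit_vec N k + M *\<^sub>v unit_vec N l"
      using M by (intro mult_vec_add) auto
    then have e: "vkron u w = M *\<^sub>v unit_vec N k + M *\<^sub>v unit_vec N l" using uw by simp
    have v: "u $ x * w $ y = a k x * b k y + a l x * b l y" if xy: "x < N" "y < 2" for x y
    proof -
      have "u $ x * w $ y = vkron u w $ (x * 2 + y)"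
        using lt[OF xy] uw by (simp add: vkron_def)
      also have "\<dots> = (M *\<^sub>v unit_vec N k) $ (x * 2 + y) + (M *\<^sub>v unit_vec N l) $ (x * 2 + y)"
        unfolding e by (rule index_add_vec(1)) (use lt[OF xy] M in simp)
      finally show ?thesis
        unfolding col[OF kl(1) lt(1)[OF xy]] col[OF kl(2) lt(1)[OF xy]] ab[OF kl(1) xy] ab[OF kl(2) xy] .
    qed
    have two: "0 < (2::nat)" "1 < (2::nat)" by simp_all
    \<comment> \<open>The 2 by 2 minors of a product vector vanish. On expanding this one, the terms
      with \<open>k\<close> alone or \<open>l\<close> alone cancel and the mixed ones
      factor.\<close>
    have "(u $ i * w $ 0) * (u $ i' * w $ 1) = (u $ i * w $ 1) * (u $ i' * w $ 0)"
      by (simp add: ac_simps)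
    then have "(a k i * b k 0 + a l i * b l 0) * (a k i' * b k 1 + a l i' * b l 1)
        = (a k i * b k 1 + a l i * b l 1) * (a k i' * b k 0 + a l i' * b l 0)"
      unfolding v[OF i(1) two(1), symmetric] v[OF i(1) two(2), symmetric]
        v[OF i(2) two(1), symmetric] v[OF i(2) two(2), symmetric] .
    then show ?thesis by (simp add: algebra_simps)
  qed
  have N0: "0 < N" using N by simp
  show ?thesis
  proof (cases "\<forall>k<N. b k 0 * b 0 1 = b k 1 * b 0 0")
    case True
    obtain j0 where j0: "j0 < 2" "b 0 j0 \<noteq> 0" using nz[OF N0] by blast
    have "\<exists>c. \<forall>j<2. b k j = c * b 0 j" if "k < N" for k
      using True that by (intro proportional[of 2 "b k" "b 0" j0] j0) (auto simp: less_2_cases_iff)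
    then obtain c where c: "\<And>k j. k < N \<Longrightarrow> j < 2 \<Longrightarrow> b k j = c k * b 0 j" by metis
    obtain r where r: "r \<noteq> 0" "adj (mat 2 1 (\<lambda>(i,_). b 0 i / r)) * mat 2 1 (\<lambda>(i,_). b 0 i / r) = 1\<^sub>m 1"
      using unit_column[of j0 2 "b 0"] j0 by metis
    define B where "B = mat 2 1 (\<lambda>(i,_). b 0 i / r)"
    \<comment> \<open>The norm \<open>r\<close> taken out of \<open>b 0\<close> and the ratios
      \<open>c k\<close> move to the other factor, leaving the product unchanged.\<close>
    define A where "A = mat N N (\<lambda>(i,k). r * c k * a k i)"
    have A: "A \<in> carrier_mat N N" and B: "B \<in> carrier_mat 2 1" by (simp_all add: A_def B_def)
    have MAB: "M = kron A B"
    proof (rule eq_matI)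
      fix i j assume "i < dim_row (kron A B)" "j < dim_col (kron A B)"
      then have i: "i < N * 2" and j: "j < N" using A B by auto
      note d = div_mod_less[OF i]
      have "kron A B $$ (i,j) = (r * c j * a j (i div 2)) * (b 0 (i mod 2) / r)"
        using i j d by (subst kron_index[OF A B]) (simp_all add: A_def B_def)
      also have "\<dots> = a j (i div 2) * b j (i mod 2)"
        using r(1) by (simp add: c[OF j d(2)])
      finally show "M $$ (i,j) = kron A B $$ (i,j)" using ab'[OF j i] by simp
    qed (use A B M in auto)
    have "adj M * M = adj A * A"
      unfolding MAB adj_kron kron_mult[OF adj_carrier[OF A] adj_carrier[OF B] A B]
      using r(2) by (simp add: B_def kron_one_right)
    \<comment> \<open>\<open>A\<close> inherits the isometry property from \<open>M\<close> since
      \<open>B\<close> is a unit column; being square, it is unitary.\<close>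
    then have "A * adj A = 1\<^sub>m N"
      using mat_mult_left_right_inverse[OF adj_carrier[OF A] A] MM by simp
    then have "M * adj M = kron (1\<^sub>m N) (B * adj B)"
      unfolding MAB adj_kron kron_mult[OF A B adj_carrier[OF A] adj_carrier[OF B]] by simp
    then show ?thesis using mult_carrier_mat[OF B adj_carrier[OF B]] by blast
  next
    case False
    then obtain k where k: "k < N" "b k 0 * b 0 1 \<noteq> b k 1 * b 0 0" by blast
    obtain i0 where i0: "i0 < N" "a 0 i0 \<noteq> 0" using nz[OF N0] by blast
    obtain i1 where i1: "i1 < N" "a k i1 \<noteq> 0" using nz[OF k(1)] by blast
    have par: "a l i * a l' i' = a l i' * a l' i"
      if "l < N" "l' < N" "i < N" "i' < N" "b l 0 * b l' 1 \<noteq> b l 1 * b l' 0" for l l' i i'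
      using pol[OF that(1-4)] that(5) by simp
    obtain d where d: "\<forall>i<N. a k i = d * a 0 i"
      using proportional[of N "a k" "a 0", OF par[OF k(1) N0 _ _ k(2)] i0] by blast
    have "\<exists>c. \<forall>i<N. a l i = c * a 0 i" if l: "l < N" for l
    proof (cases "b l 0 * b 0 1 = b l 1 * b 0 0")
      case False
      show ?thesis using proportional[of N "a l" "a 0", OF par[OF l N0 _ _ False] i0] by blast
    next
      case True
      \<comment> \<open>A nonzero \<open>b l\<close> parallel to both \<open>b 0\<close> and
        \<open>b k\<close> would make these two parallel, against the choice of
        \<open>k\<close>.\<close>
      have "b l 0 * b k 1 \<noteq> b l 1 * b k 0"
      proof
        assume *: "b l 0 * b k 1 = b l 1 * b k 0"
        obtain j where j: "j < 2" "b l j \<noteq> 0" using nz[OF l] by blast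
        have "b l 0 * (b k 0 * b 0 1 - b k 1 * b 0 0) = b k 0 * (b l 0 * b 0 1) - b 0 0 * (b l 0 * b k 1)"
          by (simp only: right_diff_distrib ac_simps)
        also have "\<dots> = 0" unfolding True * by (simp only: ac_simps diff_self)
        finally have 0: "b l 0 * (b k 0 * b 0 1 - b k 1 * b 0 0) = 0" .
        have "b l 1 * (b k 0 * b 0 1 - b k 1 * b 0 0) = b 0 1 * (b l 1 * b k 0) - b k 1 * (b l 1 * b 0 0)"
          by (simp only: right_diff_distrib ac_simps)
        also have "\<dots> = 0" unfolding True[symmetric] *[symmetric] by (simp only: ac_simps diff_self)
        finally have 1: "b l 1 * (b k 0 * b 0 1 - b k 1 * b 0 0) = 0" .
        from 0 1 have "b k 0 * b 0 1 - b k 1 * b 0 0 = 0"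
          using j by (auto simp: less_2_cases_iff)
        then show False using k(2) by simp
      qed
      then obtain c where "\<forall>i<N. a l i = c * a k i"
        using proportional[of N "a l" "a k", OF par[OF l k(1)] i1] by blast
      then have "\<forall>i<N. a l i = (c * d) * a 0 i" using d by simp
      then show ?thesis by blast
    qed
    then obtain c where c: "\<And>l i. l < N \<Longrightarrow> i < N \<Longrightarrow> a l i = c l * a 0 i" by metis
    obtain r where r: "r \<noteq> 0" "adj (mat N 1 (\<lambda>(i,_). a 0 i / r)) * mat N 1 (\<lambda>(i,_). a 0 i / r) = 1\<^sub>m 1"
      using unit_column[of i0 N "a 0"] i0 by metis
    define A where "A = mat N 1 (\<lambda>(i,_). a 0 i / r)"
    define B where "B = mat 2 N (\<lambda>(j,l). r * c l * b l j)"
    have A: "A \<in> carrier_mat N 1" and B: "B \<in> carrier_mat 2 N" by (simp_all add: A_def B_def)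
    have MAB: "M = kron A B"
    proof (rule eq_matI)
      fix i j assume "i < dim_row (kron A B)" "j < dim_col (kron A B)"
      then have i: "i < N * 2" and j: "j < N" using A B by auto
      note d = div_mod_less[OF i]
      have "kron A B $$ (i,j) = (a 0 (i div 2) / r) * (r * c j * b j (i mod 2))"
        using i j d by (subst kron_index[OF A B]) (simp_all add: A_def B_def)
      also have "\<dots> = a j (i div 2) * b j (i mod 2)"
        using r(1) by (simp add: c[OF j d(1)])
      finally show "M $$ (i,j) = kron A B $$ (i,j)" using ab'[OF j i] by simp
    qed (use A B M in auto)
    have BB: "adj B * B = 1\<^sub>m N"
      using MM unfolding MAB adj_kron kron_mult[OF adj_carrier[OF A] adj_carrier[OF B] A B]
      using r(2) by (simp add: A_def kron_one_left)
    then have N2: "N = 2" using isometry_dim_le[OF B] N by simp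
    then have "B * adj B = 1\<^sub>m 2"
      using mat_mult_left_right_inverse[of "adj B" 2 B] B BB by auto
    then have "M * adj M = kron (A * adj A) (1\<^sub>m 2)"
      unfolding MAB adj_kron kron_mult[OF A B adj_carrier[OF A] adj_carrier[OF B]] by simp
    then show ?thesis using mult_carrier_mat[OF A adj_carrier[OF A]] N2 by blast
  qed
qed

subsection \<open>Bloch components of a disentangled state\<close>

text \<open>\<open>k\<close> is the nontrivial Pauli matrix other than \<open>j\<close> and
  \<open>p\<close>; it is the letter which right multiplication by \<open>p\<close> turns into
  \<open>j\<close> up to phase.\<close>

lemma pauli_prod_third:
  assumes "j \<noteq> PI" "p \<noteq> PI" "j \<noteq> p"
  defines "k \<equiv> pauli_prod j p"
  shows "k \<noteq> PI" "k \<noteq> p" "\<exists>c. c \<noteq> 0 \<and> pauli_mat k * pauli_mat p = c \<cdot>\<^sub>m pauli_mat j"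
proof -
  have "k \<noteq> PI" "k \<noteq> p" "pauli_prod k p = j"
    using assms by (cases j; cases p; simp)+
  then show "k \<noteq> PI" "k \<noteq> p" "\<exists>c. c \<noteq> 0 \<and> pauli_mat k * pauli_mat p = c \<cdot>\<^sub>m pauli_mat j"
    using pauli_mult[of k p] by simp_all
qed

text \<open>The images are distinct and traceless, hence carry the three nontrivial Pauli matrices
  on the one qubit between \<open>xs\<close> and \<open>ys\<close>. The product of these is a
  nonzero scalar, and conjugation carries its trace back up to nonzero phases.\<close>

lemma clifford_image_all_local:
  assumes U: "unitary_op m U" and len: "\<And>X. X \<in> {A,B,C,A',B',C'} \<Longrightarrow> length X = m"
    and A: "U * pstring_mat A * adj U = a \<cdot>\<^sub>m pstring_mat A'"
    and B: "U * pstring_mat B * adj U = b \<cdot>\<^sub>m pstring_mat B'"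
    and C: "U * pstring_mat C * adj U = c \<cdot>\<^sub>m pstring_mat C'"
    and distinct: "A \<noteq> B" "B \<noteq> C" "A \<noteq> C"
    and nid: "\<And>X. X \<in> {A,B,C} \<Longrightarrow> tr (pstring_mat X) = 0"
    and loc: "\<And>X. X \<in> {A',B',C'} \<Longrightarrow> \<exists>x. X = xs @ [x] @ ys"
    and PI: "set (xs @ ys) \<subseteq> {PI}"
  shows "tr (pstring_mat A * pstring_mat B * pstring_mat C) \<noteq> 0"
proof -
  have l: "length A = m" "length B = m" "length C = m" "length A' = m" "length B' = m" "length C' = m"
    using len by auto
  note trAB = clifford_conj_trace[OF U l(1,2,3,4,5,6) A B C]
  note trBC = clifford_conj_trace[OF U l(2,3,1,5,6,4) B C A]
  note trAC = clifford_conj_trace[OF U l(1,3,2,4,6,5) A C B]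
  note trAA = clifford_conj_trace(2)[OF U l(1,1,1,4,4,4) A A A]
  note trBB = clifford_conj_trace(2)[OF U l(2,2,2,5,5,5) B B B]
  note trCC = clifford_conj_trace(2)[OF U l(3,3,3,6,6,6) C C C]
  \<comment> \<open>The square of a Pauli string has nonzero trace, so no phase vanishes.\<close>
  have abc: "a \<noteq> 0" "b \<noteq> 0" "c \<noteq> 0"
    using trAA trBB trCC l by (auto simp: tr_pstring_mult)
  \<comment> \<open>Orthogonality is preserved: equal images would give two distinct strings a
    product of nonzero trace.\<close>
  have ne: "A' \<noteq> B'" "B' \<noteq> C'" "A' \<noteq> C'"
    using trAB(2) trBC(2) trAC(2) l distinct abc by (auto simp: tr_pstring_mult)
  have "tr (pstring_mat A') = 0" "tr (pstring_mat B') = 0" "tr (pstring_mat C') = 0"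
    using trAB(1) trBC(1) clifford_conj_trace(1)[OF U l(3,3,3,6,6,6) C C C] nid abc by auto
  obtain x y z where xyz: "A' = xs @ [x] @ ys" "B' = xs @ [y] @ ys" "C' = xs @ [z] @ ys"
    using loc by (metis insertI1 insertI2)
  have 1: "x \<noteq> PI" "y \<noteq> PI" "z \<noteq> PI" 
    using \<open>tr (pstring_mat A') = 0\<close> \<open>tr (pstring_mat B') = 0\<close> \<open>tr (pstring_mat C') = 0\<close> PI
    unfolding xyz tr_pstring by (auto split: if_splits)
  have 2: "x \<noteq> y" "y \<noteq> z" "x \<noteq> z" using ne xyz by auto
  have "xs = replicate (length xs) PI" "ys = replicate (length ys) PI"
    using PI by (auto intro!: replicate_eqI)
  then have one: "pstring_mat xs = 1\<^sub>m (2 ^ length xs)" "pstring_mat ys = 1\<^sub>m (2 ^ length ys)"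
    by (metis pstring_replicate_PI)+
  have X: "pstring_mat (xs @ [w] @ ys) = kron (1\<^sub>m (2 ^ length xs)) (kron (pauli_mat w) (1\<^sub>m (2 ^ length ys)))" for w
    by (simp add: pstring_append one)
  let ?L = "2 ^ length xs :: nat" and ?R = "2 ^ length ys :: nat"
  have K: "kron (1\<^sub>m ?L) (kron S (1\<^sub>m ?R)) * kron (1\<^sub>m ?L) (kron T (1\<^sub>m ?R)) = kron (1\<^sub>m ?L) (kron (S * T) (1\<^sub>m ?R))"
    if "S \<in> carrier_mat 2 2" "T \<in> carrier_mat 2 2" for S T
    unfolding kron_mult[OF one_carrier_mat kron_carrier[OF that(1) one_carrier_mat] one_carrier_mat
        kron_carrier[OF that(2) one_carrier_mat]] kron_mult[OF that(1) one_carrier_mat that(2) one_carrier_mat]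
    by simp
  have c2: "pauli_mat x * pauli_mat y \<in> carrier_mat 2 2" "pauli_mat x * pauli_mat y * pauli_mat z \<in> carrier_mat 2 2"
    using mult_carrier_mat[of _ 2 2 _ 2] by auto
  have "tr (pstring_mat A' * pstring_mat B' * pstring_mat C')
      = of_nat ?L * (tr (pauli_mat x * pauli_mat y * pauli_mat z) * of_nat ?R)"
    unfolding xyz X K[OF pauli_carrier pauli_carrier] K[OF c2(1) pauli_carrier]
      tr_kron[OF one_carrier_mat kron_carrier[OF c2(2) one_carrier_mat]] tr_kron[OF c2(2) one_carrier_mat] tr_one ..
  then have "tr (pstring_mat A' * pstring_mat B' * pstring_mat C') \<noteq> 0"
    using tr_pauli_mult3[OF 1 2] by simp
  then show ?thesis using trAB(3) abc by simp
qed

text \<open>For the projector \<open>R\<close> onto the input state, \<open>r\<close> lists its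
  Bloch components. Two nonzero ones would yield three strings with images on one common qubit,
  contradicting that their product is traceless.\<close>

lemma clifford_pauli_rot_components:
  fixes as :: "pauli list" and p :: pauli and \<theta> :: real and R :: "complex mat"
  defines "m \<equiv> length as" and "N \<equiv> 2 ^ length as" and "E \<equiv> pauli_rot \<theta> (as @ [p])"
  defines "r \<equiv> \<lambda>i. tr (pauli_mat i * R)"
  assumes R: "R \<in> carrier_mat 2 2" and p: "p \<noteq> PI" and as: "\<not> set as \<subseteq> {PI}"
    and sc: "sin (2 * \<theta>) \<noteq> 0" "cos (2 * \<theta>) \<noteq> 0"
    and U: "is_clifford (Suc m) U"
    and proj: "(\<exists>b \<in> carrier_mat 2 2. U * (E * kron (1\<^sub>m N) R * adj E) * adj U = kron (1\<^sub>m N) b)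
      \<or> (N = 2 \<and> (\<exists>a \<in> carrier_mat 2 2. U * (E * kron (1\<^sub>m N) R * adj E) * adj U = kron a (1\<^sub>m 2)))"
    and ij: "i \<noteq> PI" "j \<noteq> PI" "i \<noteq> j" "j \<noteq> p"
  shows "r i = 0 \<or> r j = 0"
proof (rule ccontr)
  assume "\<not> ?thesis"
  then have rij: "r i \<noteq> 0" "r j \<noteq> 0" by auto
  define M where "M = N * 2"
  define P where "P = pstring_mat as"
  define S where "S = pstring_mat (as @ [p])"
  define k where "k = pauli_prod j p"
  have k: "k \<noteq> PI" "k \<noteq> p"
    using pauli_prod_third[OF ij(2) p ij(4)] by (simp_all add: k_def)
  obtain c where c: "c \<noteq> 0" "pauli_mat k * pauli_mat p = c \<cdot>\<^sub>m pauli_mat j"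
    using pauli_prod_third(3)[OF ij(2) p ij(4)] by (auto simp: k_def)
  have NM: "2 ^ Suc m = M" "2 ^ length as = N" "2 ^ length (as @ [p]) = M" by (simp_all add: m_def M_def N_def)
  have N0: "of_nat N \<noteq> (0::complex)" by (simp add: N_def)
  have P: "P \<in> carrier_mat N N" "P * P = 1\<^sub>m N" "tr P = 0"
    using as pstring_carrier[of as] pstring_sq[of as] unfolding P_def NM by (auto simp: tr_pstring)
  have S: "S = kron P (pauli_mat p)" "S \<in> carrier_mat M M"
    using pstring_carrier[of "as @ [p]"] unfolding S_def P_def NM pstring_snoc by auto
  have E: "E \<in> carrier_mat M M" "adj E \<in> carrier_mat M M" "adj E * E = 1\<^sub>m M"
    using pauli_rot_unitary[of "as @ [p]" \<theta>] adj_carrier unfolding unitary_op_def E_def NM by auto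
  have Uc: "U \<in> carrier_mat M M" "adj U \<in> carrier_mat M M" "adj U * U = 1\<^sub>m M"
    using clifford_unitary[OF U] adj_carrier unfolding unitary_op_def NM by auto
  define X where "X = kron (1\<^sub>m N) R"
  have X: "X \<in> carrier_mat M M" using R by (auto simp: X_def M_def)
  define Pr where "Pr = U * (E * X * adj E) * adj U"
  have cc: "V * W \<in> carrier_mat M M" if "V \<in> carrier_mat M M" "W \<in> carrier_mat M M" for V W :: "complex mat"
    using that by simp
  have assoc: "V * W * Z = V * (W * Z)"
    if "V \<in> carrier_mat M M" "W \<in> carrier_mat M M" "Z \<in> carrier_mat M M" for V W Z :: "complex mat"
    by (rule assoc_mult_mat[OF that])
  \<comment> \<open>Cyclicity and conjugation by \<open>U\<close> move the expectation value of
    \<open>A\<close> to its image, so a nonzero value forces the image to overlap with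
    \<open>Pr\<close>.\<close>
  have val: "tr (adj E * pstring_mat A * E * X) = a * tr (pstring_mat A' * Pr)"
    if A: "U * pstring_mat A * adj U = a \<cdot>\<^sub>m pstring_mat A'" and l: "length A = Suc m" "length A' = Suc m" for A A' a
  proof -
    have Ac: "pstring_mat A \<in> carrier_mat M M" "pstring_mat A' \<in> carrier_mat M M"
      using pstring_carrier[of A] pstring_carrier[of A'] l NM(1) by auto
    have EX: "E * X * adj E \<in> carrier_mat M M" using E X by simp
    have "tr (adj E * pstring_mat A * E * X) = tr (adj E * (pstring_mat A * E * X))"
      by (simp only: assoc cc E X Ac)
    also have "\<dots> = tr (pstring_mat A * E * X * adj E)"
      by (rule tr_mult_commute[OF E(2)]) (intro cc E X Ac)
    also have "pstring_mat A * E * X * adj E = pstring_mat A * (E * X * adj E)"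
      by (simp only: assoc cc E X Ac)
    also have "tr \<dots> = tr (U * (pstring_mat A * (E * X * adj E)) * adj U)"
      by (rule tr_conj[symmetric, OF Uc(1,2) cc[OF Ac(1) EX] Uc(3)])
    also have "U * (pstring_mat A * (E * X * adj E)) * adj U = (U * pstring_mat A * adj U) * Pr"
      unfolding Pr_def by (rule conj_mult[symmetric, OF Uc(1,2) Ac(1) EX Uc(3)])
    also have "\<dots> = a \<cdot>\<^sub>m (pstring_mat A' * Pr)"
      unfolding A by (rule smult_mult_left) (simp only: Pr_def index_mult_mat(2) carrier_matD[OF Ac(2)] carrier_matD[OF Uc(1)])
    also have "tr \<dots> = a * tr (pstring_mat A' * Pr)"
      by (rule tr_smult[of _ M]) (intro cc Ac, unfold Pr_def, intro cc Uc E X)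
    finally show ?thesis .
  qed
  have trX: "tr (kron A0 B0 * X) = tr A0 * tr (B0 * R)"
    if "A0 \<in> carrier_mat N N" "B0 \<in> carrier_mat 2 2" for A0 B0
    using that R unfolding X_def kron_mult[OF that one_carrier_mat R]
    by (simp add: tr_kron[of _ N _ 2] mult_carrier_mat[of _ 2 2 _ 2])
  \<comment> \<open>The rotation acts on the observable, and each resulting trace factors over the
    bipartition.\<close>
  have rot: "tr (adj E * kron A0 (pauli_mat q) * E * X) = (if s = 1 then tr A0 * r q
      else of_real (cos (2 * \<theta>)) * (tr A0 * r q)
        - \<i> * of_real (sin (2 * \<theta>)) * (tr (A0 * P) * tr (pauli_mat q * pauli_mat p * R)))"
    if A0: "A0 \<in> carrier_mat N N" and "S * kron A0 (pauli_mat q) = s \<cdot>\<^sub>m (kron A0 (pauli_mat q) * S)" "s = 1 \<or> s = -1"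
    for A0 q s
  proof -
    let ?A = "kron A0 (pauli_mat q)"
    have A: "?A \<in> carrier_mat (2 ^ Suc m) (2 ^ Suc m)" "?A \<in> carrier_mat M M"
      unfolding NM using A0 by (auto simp: M_def)
    have "adj E * ?A * E = (if s = 1 then ?A
        else of_real (cos (2 * \<theta>)) \<cdot>\<^sub>m ?A + (- \<i> * of_real (sin (2 * \<theta>))) \<cdot>\<^sub>m (?A * S))"
      unfolding E_def S_def using that(2,3)
      by (intro pauli_rot_conj[OF _ A(1)]) (simp_all add: S_def m_def)
    moreover have "?A * S = kron (A0 * P) (pauli_mat q * pauli_mat p)"
      unfolding S by (rule kron_mult[OF A0 pauli_carrier P(1) pauli_carrier])
    moreover have "A0 * P \<in> carrier_mat N N" "pauli_mat q * pauli_mat p \<in> carrier_mat 2 2"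
      using A0 P by (auto simp: mult_carrier_mat[of _ 2 2 _ 2])
    moreover have "tr ((x \<cdot>\<^sub>m ?A + y \<cdot>\<^sub>m (?A * S)) * X) = x * tr (?A * X) + y * tr (?A * S * X)" for x y
      unfolding linear_mult(1)[OF A(2) cc[OF A(2) S(2)] X]
      using cc[OF A(2) X] cc[OF cc[OF A(2) S(2)] X] by (simp only: tr_add[of _ M] tr_smult[of _ M] smult_carrier_mat)
    ultimately show ?thesis
      using A0 by (simp add: trX r_def del: assoc_mult_mat)
  qed
  define I where "I = replicate m PI"
  have I: "pstring_mat I = 1\<^sub>m N" "length I = m" "set I \<subseteq> {PI}"
    unfolding I_def pstring_replicate_PI by (auto simp: m_def N_def)
  \<comment> \<open>Since \<open>tr P = 0\<close>, only the first term survives: \<open>r q\<close>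
    times \<open>N\<close>, and times \<open>cos (2 * \<theta>)\<close> in the anticommuting
    case.\<close>
  have val_I: "tr (adj E * pstring_mat (I @ [q]) * E * X) \<noteq> 0" if "r q \<noteq> 0" for q
  proof -
    have "S * kron (1\<^sub>m N) (pauli_mat q) = pauli_sign p q \<cdot>\<^sub>m (kron (1\<^sub>m N) (pauli_mat q) * S)"
      unfolding S kron_mult[OF P(1) pauli_carrier one_carrier_mat pauli_carrier]
        kron_mult[OF one_carrier_mat pauli_carrier P(1) pauli_carrier] 
      using P(1) by (subst pauli_commute) (simp add: kron_smult_right)
    from rot[OF one_carrier_mat this] show ?thesis
      unfolding pstring_snoc I(1) using sc N0 that P(1,3) by (simp add: pauli_sign_def tr_one)
  qed
  \<comment> \<open>Here the first term dies by \<open>tr P = 0\<close>, and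
    \<open>P * P = 1\<^sub>m N\<close> leaves \<open>sin (2 * \<theta>)\<close> times
    \<open>r j\<close>, up to nonzero factors.\<close>
  have val_k: "tr (adj E * pstring_mat (as @ [k]) * E * X) \<noteq> 0"
  proof -
    have "S * kron P (pauli_mat k) = (-1) \<cdot>\<^sub>m (kron P (pauli_mat k) * S)"
      unfolding S kron_mult[OF P(1) pauli_carrier P(1) pauli_carrier]
      using k p by (subst pauli_commute) (simp add: kron_smult_right pauli_sign_def)
    from rot[OF P(1) this] show ?thesis
      unfolding pstring_snoc P_def[symmetric] using sc N0 rij c R P(2,3)
      by (simp add: tr_one c(2) smult_mult_left tr_smult[of _ 2] mult_carrier_mat[of _ 2 2 _ 2] r_def)
  qed
  obtain f d where f: "\<And>A. length A = Suc m \<Longrightarrow> length (f A) = Suc m \<and> U * pstring_mat A * adj U = d A \<cdot>\<^sub>m pstring_mat (f A)"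
    using U unfolding is_clifford_def by metis
  let ?strs = "{I @ [i], I @ [j], as @ [k]}"
  have strs: "length A = Suc m" "tr (pstring_mat (f A) * Pr) \<noteq> 0" if "A \<in> ?strs" for A
  proof -
    show l: "length A = Suc m" using that I by (auto simp: m_def)
    have "tr (adj E * pstring_mat A * E * X) \<noteq> 0"
      using that val_I[OF rij(1)] val_I[OF rij(2)] val_k by auto
    then show "tr (pstring_mat (f A) * Pr) \<noteq> 0" using val[of A "d A" "f A"] f[OF l] l by auto
  qed
  have loc: "\<exists>xs ys. set (xs @ ys) \<subseteq> {PI} \<and> (\<forall>A \<in> ?strs. \<exists>x. f A = xs @ [x] @ ys)"
    using proj
  proof
    assume "\<exists>b \<in> carrier_mat 2 2. U * (E * kron (1\<^sub>m N) R * adj E) * adj U = kron (1\<^sub>m N) b"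
    then obtain b where b: "b \<in> carrier_mat 2 2" "Pr = kron (1\<^sub>m N) b" by (auto simp: Pr_def X_def)
    \<comment> \<open>A nonzero overlap with \<open>kron (1\<^sub>m N) b\<close> requires a nonzero
      trace of the first \<open>m\<close> letters, so these are all \<open>PI\<close>.\<close>
    have "\<exists>x. f A = I @ [x] @ []" if A: "A \<in> ?strs" for A
    proof -
      have "length (f A) = Suc m" using f[OF strs(1)[OF A]] by simp
      then obtain D x where D: "f A = D @ [x]" "length D = m" by (cases "f A" rule: rev_cases) auto
      have Dc: "pstring_mat D \<in> carrier_mat N N" using pstring_carrier[of D] D(2) by (simp add: N_def m_def)
      have "tr (pstring_mat (f A) * Pr) = tr (pstring_mat D) * tr (pauli_mat x * b)"
        unfolding D pstring_snoc b(2) kron_mult[OF Dc pauli_carrier one_carrier_mat b(1)]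
          right_mult_one_mat[OF Dc]
        using b Dc by (simp add: tr_kron[of _ N _ 2] mult_carrier_mat[of _ 2 2 _ 2])
      then have "tr (pstring_mat D) \<noteq> 0" using strs(2)[OF A] by auto
      then have "D = I" using D(2) unfolding tr_pstring I_def
        by (auto intro!: replicate_eqI split: if_splits)
      then show ?thesis using D by simp
    qed
    then show ?thesis using I(3) by (intro exI[of _ I] exI[of _ "[]"]) simp
  next
    assume "N = 2 \<and> (\<exists>a \<in> carrier_mat 2 2. U * (E * kron (1\<^sub>m N) R * adj E) * adj U = kron a (1\<^sub>m 2))"
    then obtain a where a: "N = 2" "a \<in> carrier_mat 2 2" "Pr = kron a (1\<^sub>m 2)" by (auto simp: Pr_def X_def)
    have "(2::nat) ^ m = 2 ^ 1" using a(1) by (simp add: N_def m_def)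
    then have m1: "m = 1" by (simp only: power_inject_exp)
    \<comment> \<open>With the factors exchanged, it is the last letter that must have nonzero
      trace.\<close>
    have "\<exists>x. f A = [] @ [x] @ [PI]" if A: "A \<in> ?strs" for A
    proof -
      have "length (f A) = Suc (Suc 0)" using f[OF strs(1)[OF A]] m1 by simp
      then obtain y x where D: "f A = [y] @ [x]" by (auto simp: length_Suc_conv)
      have "tr (pstring_mat (f A) * Pr) = tr (pauli_mat y * a) * tr (pauli_mat x)"
        unfolding D pstring_snoc pstring_single a(3) kron_mult[OF pauli_carrier pauli_carrier a(2) one_carrier_mat]
        using a by (simp add: tr_kron[of _ 2 _ 2] mult_carrier_mat[of _ 2 2 _ 2])
      then have "tr (pauli_mat x) \<noteq> 0" using strs(2)[OF A] by auto
      then show ?thesis using D by (simp add: tr_pauli split: if_splits)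
    qed
    then show ?thesis by (intro exI[of _ "[]"] exI[of _ "[PI]"]) simp
  qed
  then obtain xs ys where xy: "set (xs @ ys) \<subseteq> {PI}" "\<And>A. A \<in> ?strs \<Longrightarrow> \<exists>x. f A = xs @ [x] @ ys"
    by blast
  have asI: "as \<noteq> I" using as I(3) by auto
  have "tr (pstring_mat (I @ [i]) * pstring_mat (I @ [j]) * pstring_mat (as @ [k])) \<noteq> 0"
  proof (rule clifford_image_all_local[OF clifford_unitary[OF U] _ _ _ _ _ _ _ _ _ xy(1)])
    show "U * pstring_mat (I @ [i]) * adj U = d (I @ [i]) \<cdot>\<^sub>m pstring_mat (f (I @ [i]))"
      "U * pstring_mat (I @ [j]) * adj U = d (I @ [j]) \<cdot>\<^sub>m pstring_mat (f (I @ [j]))"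
      "U * pstring_mat (as @ [k]) * adj U = d (as @ [k]) \<cdot>\<^sub>m pstring_mat (f (as @ [k]))"
      using f strs(1) by auto
    show "length A = Suc m" if "A \<in> {I @ [i], I @ [j], as @ [k], f (I @ [i]), f (I @ [j]), f (as @ [k])}" for A
      using that strs(1) f by auto
    show "I @ [i] \<noteq> I @ [j]" "I @ [j] \<noteq> as @ [k]" "I @ [i] \<noteq> as @ [k]" using ij asI by auto
    show "tr (pstring_mat A) = 0" if "A \<in> ?strs" for A using that ij k by (auto simp: tr_pstring)
    show "\<exists>x. A = xs @ [x] @ ys" if "A \<in> {f (I @ [i]), f (I @ [j]), f (as @ [k])}" for A
      using that xy(2) by auto
  qed
  \<comment> \<open>The first factor of the product is the traceless \<open>P\<close>, which
    contradicts the nonzero trace.\<close>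
  moreover have "pstring_mat (I @ [i]) * pstring_mat (I @ [j]) * pstring_mat (as @ [k])
      = kron P (pauli_mat i * pauli_mat j * pauli_mat k)"
    unfolding pstring_snoc I(1) P_def[symmetric] kron_mult[OF one_carrier_mat pauli_carrier one_carrier_mat pauli_carrier]
    using kron_mult[OF one_carrier_mat mult_carrier_mat[OF pauli_carrier pauli_carrier] P(1) pauli_carrier, of i j k] P(1)
    by simp
  ultimately show False
    using P by (simp add: tr_kron[of _ N _ 2] mult_carrier_mat[of _ 2 2 _ 2])
qed

text \<open>If the X and Y components vanish, so does one entry of \<open>\<phi>\<close>. Otherwise
  the Z component vanishes, so the entries have equal modulus; one further vanishing component makes
  their ratio real or imaginary, hence a fourth root of unity.\<close>

lemma stabilizer_if_two_components_zero:
  fixes \<phi> :: "complex vec"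
  defines "R \<equiv> mat2 (\<phi> $ 0 * cnj (\<phi> $ 0)) (\<phi> $ 0 * cnj (\<phi> $ 1)) (\<phi> $ 1 * cnj (\<phi> $ 0)) (\<phi> $ 1 * cnj (\<phi> $ 1))"
  assumes st: "is_state (Suc 0) \<phi>"
    and zero: "\<And>i j. i \<noteq> PI \<Longrightarrow> j \<noteq> PI \<Longrightarrow> i \<noteq> j \<Longrightarrow>
      tr (pauli_mat i * R) = 0 \<or> tr (pauli_mat j * R) = 0"
  shows "is_stabilizer_state (Suc 0) \<phi>"
proof -
  define x where "x = \<phi> $ 0"
  define y where "y = \<phi> $ 1"
  have X: "tr (pauli_mat PX * R) = y * cnj x + x * cnj y"
    and Y: "tr (pauli_mat PY * R) = \<i> * (x * cnj y - y * cnj x)"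
    and Z: "tr (pauli_mat PZ * R) = x * cnj x - y * cnj y"
    by (simp_all add: R_def pauli_mat2 mat2_simps x_def y_def algebra_simps)
  have "(tr (pauli_mat PX * R) = 0 \<and> tr (pauli_mat PY * R) = 0) \<or> tr (pauli_mat PZ * R) = 0"
    "tr (pauli_mat PX * R) = 0 \<or> tr (pauli_mat PY * R) = 0"
    using zero[of PX PY] zero[of PX PZ] zero[of PY PZ] by auto
  then consider "y * cnj x + x * cnj y = 0" "x * cnj y - y * cnj x = 0"
    | "x * cnj x - y * cnj y = 0" "y * cnj x + x * cnj y = 0 \<or> x * cnj y - y * cnj x = 0"
    unfolding X Y Z by auto
  then show ?thesis
  proof cases
    case 1
    then have "2 * (x * cnj y) = 0" by (simp add: algebra_simps)
    then show ?thesis using stabilizer_if_component_0[OF st] by (auto simp: x_def y_def)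
  next
    case 2
    have "x \<noteq> 0"
    proof
      assume "x = 0"
      then have "y = 0" using 2(1) by simp
      with \<open>x = 0\<close> show False using st by (simp add: is_state_1_iff x_def y_def)
    qed
    define s where "s = y / x"
    have y: "y = s * x" using \<open>x \<noteq> 0\<close> by (simp add: s_def)
    have xx: "x * cnj x \<noteq> 0" using \<open>x \<noteq> 0\<close> by simp
    have "(x * cnj x) * (1 - s * cnj s) = 0" using 2(1) by (simp add: y algebra_simps)
    then have s1: "s * cnj s = 1" using xx by simp
    have "(x * cnj x) * (s + cnj s) = 0 \<or> (x * cnj x) * (cnj s - s) = 0"
      using 2(2) by (simp add: y algebra_simps)
    then have "cnj s = -s \<or> cnj s = s" using xx by (auto simp: add_eq_0_iff)
    then have "s * s = 1 \<or> s * s = -1" using s1 by (auto simp: minus_equation_iff[of "s * s"])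
    moreover have "s * s = -1 \<Longrightarrow> (s - \<i>) * (s + \<i>) = 0" by (simp add: algebra_simps)
    ultimately have "s \<in> {1,-1,\<i>,-\<i>}" by (auto simp: square_eq_1_iff eq_neg_iff_add_eq_0[symmetric])
    then show ?thesis using stabilizer_if_component_ratio[OF st, of s] y by (simp add: x_def y_def)
  qed
qed

text \<open>Sending \<open>\<Psi>\<close> to the output state is an isometry with product image, so
  its range projector, the conjugate of the identity tensor the projector onto
  \<open>\<phi>\<close>, has one of the two local forms.\<close>

lemma product_imp_stabilizer:
  assumes p: "p \<noteq> PI" and as: "\<not> set as \<subseteq> {PI}"
    and sc: "sin (2 * \<theta>) \<noteq> 0" "cos (2 * \<theta>) \<noteq> 0"
    and st: "is_state (Suc 0) \<phi>"
    and U: "is_clifford (Suc (length as)) U"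
    and prod: "\<And>\<Psi>. is_state (length as) \<Psi> \<Longrightarrow>
      product_last (length as) (U *\<^sub>v (pauli_rot \<theta> (as @ [p]) *\<^sub>v vkron \<Psi> \<phi>))"
  shows "is_stabilizer_state (Suc 0) \<phi>"
proof -
  define N :: nat where "N = 2 ^ length as"
  define E where "E = pauli_rot \<theta> (as @ [p])"
  define R where "R = mat2 (\<phi> $ 0 * cnj (\<phi> $ 0)) (\<phi> $ 0 * cnj (\<phi> $ 1)) (\<phi> $ 1 * cnj (\<phi> $ 0)) (\<phi> $ 1 * cnj (\<phi> $ 1))"
  define F where "F = mat 2 1 (\<lambda>(i,_). \<phi> $ i)"
  define K where "K = kron (1\<^sub>m N) F"
  define G where "G = U * E"
  define M where "M = G * K"
  have dim\<phi>: "dim_vec \<phi> = 2" and norm\<phi>: "(cmod (\<phi> $ 0))\<^sup>2 + (cmod (\<phi> $ 1))\<^sup>2 = 1"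
    using st by (simp_all add: is_state_1_iff)
  have NM: "2 ^ Suc (length as) = N * 2" "2 ^ length (as @ [p]) = N * 2" by (simp_all add: N_def)
  have E: "E \<in> carrier_mat (N * 2) (N * 2)" "adj E \<in> carrier_mat (N * 2) (N * 2)" "adj E * E = 1\<^sub>m (N * 2)"
    using pauli_rot_unitary[of "as @ [p]" \<theta>] adj_carrier unfolding unitary_op_def E_def NM by auto
  have Uc: "U \<in> carrier_mat (N * 2) (N * 2)" "adj U \<in> carrier_mat (N * 2) (N * 2)" "adj U * U = 1\<^sub>m (N * 2)"
    using clifford_unitary[OF U] adj_carrier unfolding unitary_op_def NM by auto
  have F: "F \<in> carrier_mat 2 1" "adj F \<in> carrier_mat 1 2" by (auto simp: F_def)
  have K: "K \<in> carrier_mat (N * 2) N" "adj K \<in> carrier_mat N (N * 2)"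
    using F by (auto simp: K_def)
  have G: "G \<in> carrier_mat (N * 2) (N * 2)" "adj G \<in> carrier_mat (N * 2) (N * 2)"
    using Uc E adj_carrier by (auto simp: G_def)
  have adjG: "adj G = adj E * adj U" unfolding G_def by (rule adj_mult[OF Uc(1) E(1)])
  have "adj G * G = adj E * (adj U * (U * E))"
    unfolding adjG by (simp add: G_def assoc_mult_mat[OF E(2) Uc(2) mult_carrier_mat[OF Uc(1) E(1)]])
  also have "adj U * (U * E) = E"
    using assoc_mult_mat[OF Uc(2,1) E(1)] Uc(3) left_mult_one_mat[OF E(1)] by simp
  finally have GG: "adj G * G = 1\<^sub>m (N * 2)" using E(3) by simp
  have "(adj F * F) $$ (0,0) = 1"
  proof -
    have "(adj F * F) $$ (0,0) = (\<Sum>k<2. adj F $$ (0,k) * F $$ (k,0))"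
      by (rule mult_index[OF F(2,1)]) simp_all
    also have "\<dots> = of_real ((cmod (\<phi> $ 0))\<^sup>2 + (cmod (\<phi> $ 1))\<^sup>2)"
      unfolding of_real_add complex_norm_square
      by (simp add: F_def adj_index eval_nat_numeral mult.commute)
    finally show ?thesis unfolding norm\<phi> by simp
  qed
  then have FF: "adj F * F = 1\<^sub>m 1" using F by (intro eq_matI) auto
  have FR: "F * adj F = R"
  proof -
    have "(F * adj F) $$ (i,j) = \<phi> $ i * cnj (\<phi> $ j)" if "i < 2" "j < 2" for i j
      unfolding mult_index[OF F that] using that by (simp add: F_def adj_index)
    then show ?thesis
      unfolding R_def by (intro mat2_eqI[OF mult_carrier_mat[OF F]]) simp_all
  qed
  have KK: "adj K * K = 1\<^sub>m N"
    unfolding K_def adj_kron adj_one kron_mult[OF one_carrier_mat F(2) one_carrier_mat F(1)] FF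
    by (simp add: kron_one_right)
  have KR: "K * adj K = kron (1\<^sub>m N) R"
    unfolding K_def adj_kron adj_one kron_mult[OF one_carrier_mat F(1) one_carrier_mat F(2)] FR by simp
  have M: "M \<in> carrier_mat (N * 2) N" using G K by (simp add: M_def)
  have adjM: "adj M = adj K * adj G" unfolding M_def by (rule adj_mult[OF G(1) K(1)])
  have "adj M * M = adj K * (adj G * (G * K))"
    unfolding adjM unfolding M_def by (rule assoc_mult_mat[OF K(2) G(2) mult_carrier_mat[OF G(1) K(1)]])
  also have "adj G * (G * K) = K"
    using assoc_mult_mat[OF G(2,1) K(1)] GG left_mult_one_mat[OF K(1)] by simp
  finally have MM: "adj M * M = 1\<^sub>m N" using KK by simp
  define X where "X = kron (1\<^sub>m N) R"
  have X: "X \<in> carrier_mat (N * 2) (N * 2)" by (auto simp: X_def R_def)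
  have "M * adj M = G * (K * (adj K * adj G))"
    unfolding adjM unfolding M_def by (rule assoc_mult_mat[OF G(1) K(1) mult_carrier_mat[OF K(2) G(2)]])
  also have "K * (adj K * adj G) = X * adj G"
    unfolding X_def KR[symmetric] by (rule assoc_mult_mat[symmetric, OF K G(2)])
  also have "G * (X * adj G) = U * (E * (X * adj G))"
    unfolding G_def by (rule assoc_mult_mat[OF Uc(1) E(1)]) (use X G in \<open>auto simp: G_def\<close>)
  also have "E * (X * adj G) = E * X * adj E * adj U"
  proof -
    have "E * (X * adj G) = E * (X * adj E * adj U)"
      unfolding adjG by (subst assoc_mult_mat[OF X E(2) Uc(2)]) simp
    also have "\<dots> = E * (X * adj E) * adj U"
      by (rule assoc_mult_mat[symmetric, OF E(1) mult_carrier_mat[OF X E(2)] Uc(2)])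
    also have "E * (X * adj E) = E * X * adj E"
      by (rule assoc_mult_mat[symmetric, OF E(1) X E(2)])
    finally show ?thesis .
  qed
  also have "U * (E * X * adj E * adj U) = U * (E * X * adj E) * adj U"
    by (rule assoc_mult_mat[symmetric, OF Uc(1) mult_carrier_mat[OF mult_carrier_mat[OF E(1) X] E(2)] Uc(2)])
  finally have MX: "M * adj M = U * (E * X * adj E) * adj U" .
  have Mv: "M *\<^sub>v v = U *\<^sub>v (E *\<^sub>v vkron v \<phi>)" if v: "v \<in> carrier_vec N" for v
  proof -
    \<comment> \<open>Tensoring with the one-dimensional vector 1 exhibits \<open>v\<close> as a
      product, on which the Kronecker product \<open>K\<close> can act.\<close>
    let ?e = "vec 1 (\<lambda>_. 1) :: complex vec"
    have e: "vkron v ?e = v" by (rule eq_vecI) (auto simp: vkron_def)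
    have Fe: "F *\<^sub>v ?e = \<phi>"
      using dim\<phi> by (intro eq_vecI) (auto simp: F_def scalar_prod_def)
    have "K *\<^sub>v v = K *\<^sub>v vkron v ?e" unfolding e ..
    also have "\<dots> = vkron v \<phi>"
      unfolding K_def kron_mult_vec[OF one_carrier_mat F(1) v vec_carrier] Fe one_mult_mat_vec[OF v] ..
    finally have Kv: "K *\<^sub>v v = vkron v \<phi>" .
    have vk: "vkron v \<phi> \<in> carrier_vec (N * 2)" using v dim\<phi> by (intro carrier_vecI) simp
    have "M *\<^sub>v v = G *\<^sub>v (K *\<^sub>v v)"
      unfolding M_def by (rule assoc_mult_mat_vec[OF G(1) K(1) v])
    also have "\<dots> = U *\<^sub>v (E *\<^sub>v vkron v \<phi>)"
      unfolding Kv G_def by (rule assoc_mult_mat_vec[OF Uc(1) E(1) vk])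
    finally show ?thesis .
  qed
  \<comment> \<open>The hypothesis covers unit vectors; other nonzero vectors are rescaled, and the
    zero vector is a product trivially.\<close>
  have Mprod: "\<exists>a b. dim_vec a = N \<and> dim_vec b = 2 \<and> M *\<^sub>v v = vkron a b" if v: "v \<in> carrier_vec N" for v
  proof -
    define q where "q = (\<Sum>i<N. (cmod (v $ i))\<^sup>2)"
    define r where "r = complex_of_real (sqrt q)"
    show ?thesis
    proof (cases "q = 0")
      case True
      then have "\<forall>i<N. v $ i = 0"
        unfolding q_def by (subst (asm) sum_nonneg_eq_0_iff) auto
      then have "v = 0\<^sub>v N" using v by (intro eq_vecI) auto
      then have "M *\<^sub>v v = 0\<^sub>v (N * 2)"
        using M by (intro eq_vecI) (auto simp: scalar_prod_def)
      also have "\<dots> = vkron (0\<^sub>v N) (0\<^sub>v 2)" by (rule eq_vecI) (simp_all add: vkron_def div_mod_less)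
      finally show ?thesis by (intro exI[of _ "0\<^sub>v N"] exI[of _ "0\<^sub>v 2"]) simp
    next
      case False
      moreover have "q \<ge> 0" unfolding q_def by (intro sum_nonneg) simp
      ultimately have q: "q > 0" by simp
      have r: "r \<noteq> 0" "(cmod r)\<^sup>2 = q" using q by (simp_all add: r_def)
      define w where "w = (1 / r) \<cdot>\<^sub>v v"
      have w: "w \<in> carrier_vec N" "v = r \<cdot>\<^sub>v w"
        using v r(1) by (simp_all add: w_def smult_smult_assoc)
      have "(\<Sum>i<N. (cmod (w $ i))\<^sup>2) = (\<Sum>i<N. (cmod (v $ i))\<^sup>2 / q)"
        using v by (intro sum.cong) (auto simp: w_def norm_divide power_divide r(2))
      also have "\<dots> = 1" using q by (simp add: q_def flip: sum_divide_distrib)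
      finally have "is_state (length as) w"
        using w(1) by (simp add: is_state_def N_def)
      from prod[OF this] obtain a b where ab: "dim_vec a = N" "dim_vec b = 2" "M *\<^sub>v w = vkron a b"
        using Mv[OF w(1)] by (auto simp: product_last_def N_def E_def)
      have "M *\<^sub>v v = vkron (r \<cdot>\<^sub>v a) b"
        unfolding w(2) vkron_smult_left ab(3)[symmetric] by (rule mult_mat_vec[OF M w(1)])
      then show ?thesis using ab by (intro exI[of _ "r \<cdot>\<^sub>v a"] exI[of _ b]) simp
    qed
  qed
  have "length as \<noteq> 0" using as by auto
  then have N2: "N \<ge> 2" using self_le_power[of "2::nat" "length as"] by (simp add: N_def)
  note proj = product_isometry_projector[OF M MM N2 Mprod, unfolded MX X_def N_def E_def]
  have R: "R \<in> carrier_mat 2 2" by (simp add: R_def)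
  \<comment> \<open>At least one of \<open>i\<close> and \<open>j\<close> differs from
    \<open>p\<close>, so the component lemma applies in one of the two orders.\<close>
  have "tr (pauli_mat i * R) = 0 \<or> tr (pauli_mat j * R) = 0"
    if "i \<noteq> PI" "j \<noteq> PI" "i \<noteq> j" for i j
    using clifford_pauli_rot_components[OF R p as sc U proj that]
      clifford_pauli_rot_components[OF R p as sc U proj that(2,1) that(3)[symmetric]] that by auto
  then show ?thesis
    unfolding R_def by (rule stabilizer_if_two_components_zero[OF st])
qed

section \<open>Combination of the two directions after splitting off the last letter\<close>

theorem theorem1:
  fixes n :: nat and ps :: "pauli list" and \<theta> :: real and \<phi> :: "complex vec"
  assumes "n \<ge> 2"
    and "length ps = n"
    and "ps ! (n - 1) \<noteq> PI"
    and "\<exists>j < n - 1. ps ! j \<noteq> PI"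
    and "\<not> is_clifford n (pauli_rot \<theta> ps)"
    and "is_state 1 \<phi>"
  shows "(\<exists>U. is_clifford n U \<and>
            (\<forall>\<Psi>. is_state (n - 1) \<Psi> \<longrightarrow>
               product_last (n - 1) (U *\<^sub>v (pauli_rot \<theta> ps *\<^sub>v vkron \<Psi> \<phi>))))
         \<longleftrightarrow> is_stabilizer_state 1 \<phi>"
proof -
  obtain as p where ps: "ps = as @ [p]"
    using assms(1,2) by (cases ps rule: rev_cases) auto
  have n: "n = Suc (length as)" using assms(2) ps by simp
  have p: "p \<noteq> PI" using assms(3) by (simp add: ps n nth_append)
  obtain j where "j < length as" "as ! j \<noteq> PI"
    using assms(4) by (auto simp: ps n nth_append)
  then have as: "\<not> set as \<subseteq> {PI}" using nth_mem by fastforce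
  \<comment> \<open>If either value vanished, the rotation would be Clifford.\<close>
  have sc: "sin (2 * \<theta>) \<noteq> 0" "cos (2 * \<theta>) \<noteq> 0"
    using pauli_rot_clifford[of \<theta> ps] assms(2,5) by auto
  have st: "is_state (Suc 0) \<phi>" and dim: "dim_vec \<phi> = 2"
    using assms(6) is_state_1_iff by simp_all
  have "is_stabilizer_state (Suc 0) \<phi>"
    if "is_clifford n U" "\<And>\<Psi>. is_state (n - 1) \<Psi> \<Longrightarrow>
      product_last (n - 1) (U *\<^sub>v (pauli_rot \<theta> ps *\<^sub>v vkron \<Psi> \<phi>))" for U
    using product_imp_stabilizer[OF p as sc st, of U] that by (simp add: ps n)
  moreover have "\<exists>U. is_clifford n U \<and> (\<forall>\<Psi>. is_state (n - 1) \<Psi> \<longrightarrow>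
      product_last (n - 1) (U *\<^sub>v (pauli_rot \<theta> ps *\<^sub>v vkron \<Psi> \<phi>)))"
    if "is_stabilizer_state (Suc 0) \<phi>"
    using stabilizer_imp_product[OF that dim, of as \<theta> p] by (auto simp: ps n is_state_def)
  ultimately show ?thesis by (metis One_nat_def)
qed

end
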